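(* Let $N\ge 2$, $1\le p\le N$ and let $q\ge p$ be such that $q<p^*=\frac{Np}{N-p}$ if $1\le p<N$, and $q<\infty$ if $p=N$. Let $\Omega \subseteq \mathbb{R}^N$ be an open set such that $\theta^*_{\Omega,r_0}(t)>0$ for some $r_0>0$ and $t\ge 0$. Then \[ \lambda_{p,q}(\Omega)>0\qquad\Longleftrightarrow \qquad r_\Omega<+\infty. \] Moreover, if \[ t\le t_0,\qquad\theta^*_{\Omega,r_0}(t)\ge \theta>0\qquad \text{and}\qquad 0<\kappa_1\le \frac{r_0}{r_\Omega}\le \kappa_2, \] then \[ \frac{c}{r_\Omega^{\,p-N+N\frac{p}{q}}}\le\lambda_{p,q}(\Omega)\le \frac{\lambda_{p,q}(B_1)}{r_\Omega^{\,p-N+N\frac{p}{q}}}, \] for some constant $c>0$ depending only on $N,p,q,t_0,\theta,\kappa_1,\kappa_2$. Finally, if $t_0=0$, the constant $c$ can be taken independent of $\kappa_2$.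
   Context: $B_r(x)$ is the open Euclidean ball in $\mathbb{R}^N$ of center $x$ and radius $r$, $B_1$ is the unit ball centered at the origin; $|\cdot|$ is Lebesgue measure; $C^\infty_0(\Omega)$ is the space of smooth functions with compact support in $\Omega$. Inradius: $r_\Omega=\sup\{r>0 : \text{there exists a ball } B_r(x_0)\subseteq\Omega\}$. Sharp Poincaré–Sobolev constant: $\lambda_{p,q}(\Omega)=\inf\{\int_\Omega |\nabla \varphi|^p\,dx : \varphi\in C^\infty_0(\Omega),\ \|\varphi\|_{L^q(\Omega)}=1\}$. Measure density index: for $r_0>0$, $t\ge 0$, \[ \theta^*_{\Omega,r_0}(t)=\inf\left\{\left(\frac{r_0}{r}\right)^t\,\frac{|B_r(x)\setminus \Omega|}{|B_r(x)|} : x\in \partial \Omega,\ 0 < r \le r_0\right\}. \] *)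

theory Defs
  imports "HOL-Analysis.Analysis"
begin

fun Ck :: "nat \<Rightarrow> ('a::euclidean_space \<Rightarrow> real) \<Rightarrow> bool" where
  "Ck 0 f \<longleftrightarrow> continuous_on UNIV f"
| "Ck (Suc k) f \<longleftrightarrow> (\<forall>x. f differentiable (at x)) \<and>
     (\<forall>v. Ck k (\<lambda>x. frechet_derivative f (at x) v))"

definition smooth :: "('a::euclidean_space \<Rightarrow> real) \<Rightarrow> bool" where
  "smooth f \<longleftrightarrow> (\<forall>k. Ck k f)"

text \<open>Test functions on \<open>\<Omega>\<close> are represented by their extension by zero to the whole space.\<close>

definition test_functions :: "'a::euclidean_space set \<Rightarrow> ('a \<Rightarrow> real) set" where
  "test_functions \<Omega> = {\<phi>. smooth \<phi> \<and> compact (closure {x. \<phi> x \<noteq> 0}) \<and> closure {x. \<phi> x \<noteq> 0} \<subseteq> \<Omega>}"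

definition gradient :: "('a::euclidean_space \<Rightarrow> real) \<Rightarrow> 'a \<Rightarrow> 'a" where
  "gradient f x = (\<Sum>b\<in>Basis. frechet_derivative f (at x) b *\<^sub>R b)"

lemma gderiv_gradient:
  assumes "f differentiable (at x)"
  shows "GDERIV f x :> gradient f x"
proof -
  have D: "(f has_derivative frechet_derivative f (at x)) (at x)"
    using assms frechet_derivative_works by blast
  then interpret linear "frechet_derivative f (at x)"
    by (rule has_derivative_linear)
  have "frechet_derivative f (at x) h = h \<bullet> gradient f x" for h
  proof -
    have "frechet_derivative f (at x) h = frechet_derivative f (at x) (\<Sum>b\<in>Basis. (h \<bullet> b) *\<^sub>R b)"
      by (simp add: euclidean_representation)
    also have "\<dots> = (\<Sum>b\<in>Basis. (h \<bullet> b) * frechet_derivative f (at x) b)"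
      by (simp add: sum scale)
    also have "\<dots> = h \<bullet> gradient f x"
      by (simp add: gradient_def inner_sum_right mult.commute)
    finally show ?thesis .
  qed
  then have "frechet_derivative f (at x) = (\<lambda>h. h \<bullet> gradient f x)" by auto
  with D show ?thesis by (simp add: gderiv_def)
qed

text \<open>The Bochner integrals below are only applied to test functions, whose integrands are
  continuous with compact support, so the value 0 of a non-integrable integrand never occurs.\<close>

definition Lq_norm :: "real \<Rightarrow> 'a::euclidean_space set \<Rightarrow> ('a \<Rightarrow> real) \<Rightarrow> real" where
  "Lq_norm q \<Omega> u = (LINT x:\<Omega>|lborel. \<bar>u x\<bar> powr q) powr (1 / q)"

text \<open>Infima and suprema are taken in \<open>[0, \<infinity>]\<close>, so the infimum of the empty set is \<open>\<infinity>\<close>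
  and its supremum is 0. This concerns \<open>\<Omega> = {}\<close> and, for \<open>density_index\<close>, also \<open>\<Omega> = UNIV\<close>.\<close>

definition poincare_sobolev_const :: "real \<Rightarrow> real \<Rightarrow> 'a::euclidean_space set \<Rightarrow> ennreal" where
  "poincare_sobolev_const p q \<Omega> =
     (INF \<phi>\<in>{\<phi> \<in> test_functions \<Omega>. Lq_norm q \<Omega> \<phi> = 1}.
        ennreal (LINT x:\<Omega>|lborel. norm (gradient \<phi> x) powr p))"

definition inradius :: "'a::euclidean_space set \<Rightarrow> ennreal" where
  "inradius \<Omega> = Sup {ennreal r | r. 0 < r \<and> (\<exists>x0. ball x0 r \<subseteq> \<Omega>)}"

definition density_index :: "'a::euclidean_space set \<Rightarrow> real \<Rightarrow> real \<Rightarrow> ennreal" where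
  "density_index \<Omega> r0 t =
     Inf {ennreal ((r0 / r) powr t * (measure lborel (ball x r - \<Omega>) / measure lborel (ball x r)))
          | x r. x \<in> frontier \<Omega> \<and> 0 < r \<and> r \<le> r0}"

text \<open>The two-sided bound of the theorem. It is only used under a hypothesis forcing
  \<open>0 < inradius \<Omega> < \<infinity>\<close>, where \<open>enn2real\<close> loses no information.\<close>

definition inradius_bounds :: "real \<Rightarrow> real \<Rightarrow> real \<Rightarrow> 'a::euclidean_space set \<Rightarrow> bool" where
  "inradius_bounds c p q \<Omega> \<longleftrightarrow>
     (let N = real DIM('a); R = enn2real (inradius \<Omega>) powr (p - N + N * p / q)
      in ennreal c / ennreal R \<le> poincare_sobolev_const p q \<Omega> \<and>
         poincare_sobolev_const p q \<Omega> \<le> poincare_sobolev_const p q (ball (0::'a) 1) / ennreal R)"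

end

theory Submission
  imports Defs
begin

text \<open>
  Write \<open>N\<close> for the dimension and \<open>\<alpha> = p - N + N p / q\<close>; subcriticality of \<open>q\<close> says exactly that
  \<open>\<alpha> > 0\<close>. Everything is governed by the scaling law \<open>\<lambda>(B\<^sub>r) = \<lambda>(B\<^sub>1) r powr (-\<alpha>)\<close>.

  Upper bound. Since \<open>\<lambda>\<close> decreases when the domain grows, every ball contained in \<open>\<Omega>\<close> gives
  \<open>\<lambda>(\<Omega>) \<le> \<lambda>(B\<^sub>1) r powr (-\<alpha>)\<close> (lemma \<open>poincare_sobolev_const_scaling\<close>). Letting \<open>r\<close> tend to the inradius
  gives the upper bound, and \<open>\<lambda>(\<Omega>) = 0\<close> if the inradius is infinite. The latter needs \<open>\<lambda>(B\<^sub>1) < \<infinity>\<close>,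
  that is, one nonzero test function; it is built from \<open>exp (-1/s)\<close>.

  Lower bound. Let \<open>R\<close> be the inradius. A ball of radius \<open>2 R\<close> is not contained in \<open>\<Omega>\<close>, so it either misses
  \<open>\<Omega>\<close> or meets its frontier, where the density condition applies; in both cases the complement of \<open>\<Omega>\<close>
  fills a fixed fraction of every ball of radius \<open>3 R\<close> (lemma \<open>complement_density\<close>). A test function \<open>u\<close> thus
  vanishes at many points near each \<open>x\<close>. Integrating the gradient along the segments from \<open>x\<close> to these
  points gives
    \<open>\<sigma> \<bar>u x\<bar> \<le> d \<integral>\<^sub>0\<^sup>1 \<integral>\<^bsub>\<bar>w\<bar> < d\<^esub> \<bar>\<nabla>u (x + t w)\<bar> dw dt\<close>, where \<open>d = 3 R\<close>.
  For fixed \<open>t\<close> the inner integral is an average of \<open>\<bar>\<nabla>u\<bar>\<close> at scale \<open>t d\<close>, which maps \<open>L\<^sup>p\<close> to \<open>L\<^sup>q\<close> with norm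
  of order \<open>t powr (-b)\<close>, \<open>b = N (1/p - 1/q)\<close>. Because \<open>1 - b = \<alpha> / p > 0\<close>, this is integrable in \<open>t\<close>, so
  the \<open>L\<^sup>q\<close> norm of \<open>u\<close> is bounded by the \<open>L\<^sup>p\<close> norm of its gradient (lemma \<open>subcritical_sobolev_estimate\<close>).
  The averages are translation invariant, so the estimate is global from the start.
\<close>

section \<open>Calculus of \<open>Ck\<close> functions\<close>

text \<open>Reduces \<open>Ck (Suc k)\<close> to any explicit derivative instead of \<open>frechet_derivative\<close>.\<close>

lemma Ck_SucI:
  assumes "\<And>x. (f has_derivative f' x) (at x)" and "\<And>v. Ck k (\<lambda>x. f' x v)"
  shows "Ck (Suc k) f"
proof -
  have "frechet_derivative f (at x) = f' x" for x
    using frechet_derivative_at[OF assms(1)] by simp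
  then show ?thesis
    using assms by (auto simp: differentiable_def)
qed

lemma Ck_Suc_imp_Ck: "Ck (Suc k) f \<Longrightarrow> Ck k f"
proof (induction k arbitrary: f)
  case 0
  then show ?case
    by (auto intro!: differentiable_imp_continuous_on simp: differentiable_on_def)
next
  case (Suc k)
  then show ?case by (metis Ck.simps(2))
qed

lemma Ck_const: "Ck k (\<lambda>x. c)"
proof (induction k arbitrary: c)
  case (Suc k)
  show ?case by (rule Ck_SucI[where f'="\<lambda>x v. 0"]) (auto intro: Suc)
qed auto

lemma Ck_add: "Ck k f \<Longrightarrow> Ck k g \<Longrightarrow> Ck k (\<lambda>x. f x + g x)"
proof (induction k arbitrary: f g)
  case (Suc k)
  show ?case
    by (rule Ck_SucI[where f'="\<lambda>x v. frechet_derivative f (at x) v + frechet_derivative g (at x) v"])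
      (use Suc in \<open>auto intro!: has_derivative_add simp: frechet_derivative_works[symmetric]\<close>)
qed (auto intro: continuous_intros)

lemma Ck_mult: "Ck k f \<Longrightarrow> Ck k g \<Longrightarrow> Ck k (\<lambda>x. f x * g x)"
proof (induction k arbitrary: f g)
  case (Suc k)
  note lower = Suc.prems[THEN Ck_Suc_imp_Ck]
  show ?case
    by (rule Ck_SucI[where f'="\<lambda>x v. f x * frechet_derivative g (at x) v + frechet_derivative f (at x) v * g x"])
      (use Suc lower in \<open>auto intro!: has_derivative_mult Ck_add Suc.IH
          simp: frechet_derivative_works[symmetric]\<close>)
qed (auto intro: continuous_intros)

lemma Ck_inner_left: "Ck k (\<lambda>x. x \<bullet> v)"
proof (cases k)
  case (Suc k)
  have "Ck (Suc k) (\<lambda>x. x \<bullet> v)"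
    by (rule Ck_SucI[where f'="\<lambda>x h. h \<bullet> v"]) (auto intro: Ck_const derivative_eq_intros)
  with Suc show ?thesis by simp
qed (auto intro: continuous_intros)

lemma has_derivative_compose_affine:
  fixes f :: "'a::euclidean_space \<Rightarrow> real"
  assumes "f differentiable (at (a + s *\<^sub>R x))"
  shows "((\<lambda>x. f (a + s *\<^sub>R x)) has_derivative
     (\<lambda>v. s * frechet_derivative f (at (a + s *\<^sub>R x)) v)) (at x)"
proof -
  let ?D = "frechet_derivative f (at (a + s *\<^sub>R x))"
  have D: "(f has_derivative ?D) (at (a + s *\<^sub>R x))"
    using assms frechet_derivative_works by blast
  have A: "((\<lambda>x. a + s *\<^sub>R x) has_derivative (\<lambda>v. s *\<^sub>R v)) (at x)"
    by (auto intro!: derivative_eq_intros)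
  have "((\<lambda>x. f (a + s *\<^sub>R x)) has_derivative (\<lambda>v. ?D (s *\<^sub>R v))) (at x)"
    using diff_chain_at[OF A D] by (simp add: o_def)
  then show ?thesis
    using linear_scale[OF has_derivative_linear[OF D]] by simp
qed

lemma Ck_compose_affine:
  "Ck k f \<Longrightarrow> Ck k (\<lambda>x. f (a + s *\<^sub>R x))"
proof (induction k arbitrary: f)
  case 0
  then have "continuous_on UNIV (f \<circ> (\<lambda>x. a + s *\<^sub>R x))"
    by (intro continuous_on_compose continuous_intros) (auto elim: continuous_on_subset)
  then show ?case by (simp add: o_def)
next
  case (Suc k)
  show ?case
    by (rule Ck_SucI[where f'="\<lambda>x v. s * frechet_derivative f (at (a + s *\<^sub>R x)) v"])
      (use Suc in \<open>auto intro!: has_derivative_compose_affine Ck_mult Ck_const\<close>)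
qed

section \<open>A bump function\<close>

text \<open>The function \<open>exp (-1/s)\<close>, extended by \<open>0\<close>, is smooth at the origin. The factor \<open>s powr (-n)\<close> makes
  the family closed under differentiation up to linear combinations, so that all orders can be treated
  by one induction.\<close>

definition flat :: "nat \<Rightarrow> real \<Rightarrow> real" where
  "flat n s = (if s \<le> 0 then 0 else inverse s ^ n * exp (- inverse s))"

lemma flat_tendsto_0: "((\<lambda>s. inverse s ^ n * exp (- inverse s)) \<longlongrightarrow> 0) (at_right (0::real))"
proof -
  have "((\<lambda>y::real. y ^ n / exp y) \<longlongrightarrow> 0) at_top"
    by (rule tendsto_power_div_exp_0)
  then have "((\<lambda>s::real. inverse s ^ n / exp (inverse s)) \<longlongrightarrow> 0) (at_right 0)"
    by (rule filterlim_compose[OF _ filterlim_inverse_at_top_right])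
  then show ?thesis by (simp add: exp_minus field_simps)
qed

lemma flat_has_derivative:
  "(flat n has_real_derivative flat (n + 2) s - real n * flat (n + 1) s) (at s)"
proof -
  consider "s > 0" | "s < 0" | "s = 0" by linarith
  then show ?thesis
  proof cases
    case 1
    have "((\<lambda>s. inverse s ^ n * exp (- inverse s)) has_real_derivative
        flat (n + 2) s - real n * flat (n + 1) s) (at s)"
    proof -
      have D: "((\<lambda>s. inverse s ^ n * exp (- inverse s)) has_real_derivative
          real n * inverse s ^ (n - 1) * (- (inverse s)\<^sup>2) * exp (- inverse s)
          + inverse s ^ n * (exp (- inverse s) * (inverse s)\<^sup>2)) (at s)"
        using 1 by (auto intro!: derivative_eq_intros simp: power2_eq_square)
      have n: "real n * inverse s ^ (n - 1) * (inverse s)\<^sup>2 = real n * inverse s ^ (n + 1)"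
        by (cases n) (simp_all add: power2_eq_square)
      have "real n * inverse s ^ (n - 1) * (- (inverse s)\<^sup>2) * exp (- inverse s)
          + inverse s ^ n * (exp (- inverse s) * (inverse s)\<^sup>2)
          = inverse s ^ (n + 2) * exp (- inverse s)
          - (real n * inverse s ^ (n - 1) * (inverse s)\<^sup>2) * exp (- inverse s)"
        by (simp add: power_add power2_eq_square algebra_simps)
      also have "\<dots> = flat (n + 2) s - real n * flat (n + 1) s"
        using 1 by (simp only: n) (simp add: flat_def)
      finally show ?thesis using D by simp
    qed
    then show ?thesis
      by (rule has_field_derivative_transform_within_open[where S="{0<..}"])
        (use 1 in \<open>auto simp: flat_def\<close>)
  next
    case 2
    have "((\<lambda>s. 0) has_real_derivative flat (n + 2) s - real n * flat (n + 1) s) (at s)"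
      using 2 by (auto simp: flat_def)
    then show ?thesis
      by (rule has_field_derivative_transform_within_open[where S="{..<0}"])
        (use 2 in \<open>auto simp: flat_def\<close>)
  next
    case 3
    \<comment> \<open>At the origin the difference quotient \<open>flat n h / h\<close> is \<open>flat (n + 1) h\<close> for \<open>h > 0\<close>, which tends to \<open>0\<close>.\<close>
    have "((\<lambda>h. flat n h / h) \<longlongrightarrow> 0) (at_right 0)"
      by (rule Lim_transform_eventually[OF flat_tendsto_0[of "Suc n"]])
        (auto simp: eventually_at_right_field flat_def field_simps intro!: exI[of _ 1])
    moreover have "((\<lambda>h. flat n h / h) \<longlongrightarrow> 0) (at_left 0)"
      by (rule Lim_transform_eventually[OF tendsto_const])
        (auto simp: eventually_at_left_field flat_def intro!: exI[of _ "-1"])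
    ultimately have "((\<lambda>h. flat n h / h) \<longlongrightarrow> 0) (at 0)"
      by (simp add: filterlim_at_split)
    then show ?thesis using 3 by (simp add: DERIV_def flat_def)
  qed
qed

text \<open>The induction on \<open>k\<close> must range over all \<open>n\<close>, because the derivative of \<open>flat n\<close> involves
  \<open>flat (n + 1)\<close> and \<open>flat (n + 2)\<close>. The remaining factor \<open>-2 (x \<bullet> v)\<close> is linear in \<open>x\<close>.\<close>

lemma Ck_flat_ball: "Ck k (\<lambda>x::'a::euclidean_space. flat n (1/4 - x \<bullet> x))"
proof (induction k arbitrary: n)
  case 0
  have "isCont (flat n) s" for s using flat_has_derivative DERIV_isCont by blast
  then have "continuous_on UNIV (flat n)" by (simp add: continuous_at_imp_continuous_on)
  then show ?case
    by (auto intro!: continuous_intros continuous_on_compose2[where f="\<lambda>x. 1/4 - x \<bullet> x" and g="flat n"])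
next
  case (Suc k)
  define D where "D = (\<lambda>s. flat (n + 2) s - real n * flat (n + 1) s)"
  show ?case
  proof (rule Ck_SucI[where f'="\<lambda>x v. D (1/4 - x \<bullet> x) * (- 2 * (x \<bullet> v))"])
    fix x :: 'a
    have F: "(flat n has_derivative (\<lambda>h. D (1/4 - x \<bullet> x) * h)) (at (1/4 - x \<bullet> x))"
      using flat_has_derivative[of n "1/4 - x \<bullet> x"]
      by (simp add: has_field_derivative_def D_def)
    have "((\<lambda>x::'a. 1/4 - x \<bullet> x) has_derivative (\<lambda>v. - 2 * (x \<bullet> v))) (at x)"
      by (auto intro!: derivative_eq_intros simp: inner_commute)
    from diff_chain_at[OF this F]
    show "((\<lambda>x. flat n (1/4 - x \<bullet> x)) has_derivative (\<lambda>v. D (1/4 - x \<bullet> x) * (- 2 * (x \<bullet> v)))) (at x)"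
      by (simp add: o_def)
  next
    fix v :: 'a
    have "Ck k (\<lambda>x::'a. flat (n + 2) (1/4 - x \<bullet> x) + - real n * flat (n + 1) (1/4 - x \<bullet> x))"
      by (intro Ck_add Ck_mult Ck_const Suc)
    then have "Ck k (\<lambda>x::'a. D (1/4 - x \<bullet> x))" by (simp add: D_def)
    then show "Ck k (\<lambda>x::'a. D (1/4 - x \<bullet> x) * (- 2 * (x \<bullet> v)))"
      by (intro Ck_mult Ck_const Ck_inner_left)
  qed
qed

text \<open>The radius \<open>1/2\<close> leaves room for the closed support inside the open unit ball.\<close>

lemma flat_ball_test_function:
  "(\<lambda>x::'a::euclidean_space. flat 0 (1/4 - x \<bullet> x)) \<in> test_functions (ball 0 1)"
proof -
  have "{x::'a. flat 0 (1/4 - x \<bullet> x) \<noteq> 0} \<subseteq> cball 0 (1/2)"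
  proof
    fix x :: 'a assume "x \<in> {x. flat 0 (1/4 - x \<bullet> x) \<noteq> 0}"
    then have "norm x ^ 2 < (1/2)^2"
      by (auto simp: flat_def dot_square_norm power2_eq_square split: if_splits)
    then show "x \<in> cball 0 (1/2)"
      by (auto dest: power_less_imp_less_base)
  qed
  then have *: "closure {x::'a. flat 0 (1/4 - x \<bullet> x) \<noteq> 0} \<subseteq> cball 0 (1/2)"
    by (rule closure_minimal) auto
  moreover have "cball 0 (1/2) \<subseteq> ball (0::'a) 1" by auto
  ultimately show ?thesis
    using bounded_subset[OF bounded_cball *]
    by (auto simp: test_functions_def smooth_def Ck_flat_ball compact_eq_bounded_closed)
qed

section \<open>Averages along segments\<close>

lemma nn_integral_lborel_scale:
  fixes f :: "'a::euclidean_space \<Rightarrow> ennreal"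
  assumes [measurable]: "f \<in> borel_measurable borel" and "0 < c"
  shows "(\<integral>\<^sup>+x. f (a + c *\<^sub>R x) \<partial>lborel) = ennreal (c powr - real DIM('a)) * (\<integral>\<^sup>+x. f x \<partial>lborel)"
proof -
  have "(\<integral>\<^sup>+x. f x \<partial>lborel) = ennreal (c ^ DIM('a)) * (\<integral>\<^sup>+x. f (a + c *\<^sub>R x) \<partial>lborel)"
    using \<open>0 < c\<close> by (subst lborel_affine[of c a])
      (simp_all add: nn_integral_density nn_integral_distr nn_integral_cmult)
  moreover have "ennreal (c powr - real DIM('a)) * ennreal (c ^ DIM('a)) = 1"
    using \<open>0 < c\<close> by (simp add: ennreal_mult[symmetric] powr_minus powr_realpow)
  ultimately show ?thesis by (simp add: mult.assoc[symmetric])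
qed

lemma nn_integral_lborel_translation:
  fixes f :: "'a::euclidean_space \<Rightarrow> ennreal"
  assumes [measurable]: "f \<in> borel_measurable borel"
  shows "(\<integral>\<^sup>+x. f (x + a) \<partial>lborel) = (\<integral>\<^sup>+x. f x \<partial>lborel)"
  using nn_integral_lborel_scale[of f 1 a] by (simp add: add.commute)

text \<open>The graph of the convex function \<open>\<lambda>f. f powr q\<close> lies above its tangent at \<open>c\<close>. All terms are
  nonnegative in this form, so the inequality can be integrated in \<open>[0, \<infinity>]\<close>.\<close>

lemma powr_tangent_le:
  fixes f c q :: real
  assumes "1 \<le> q" "0 \<le> f" "0 < c"
  shows "q * c powr (q - 1) * f \<le> f powr q + (q - 1) * c powr q"
proof (cases "f = 0")
  case False
  have "(f powr q) powr (1/q) * (c powr q) powr (1 - 1/q) \<le> (1/q) * f powr q + (1 - 1/q) * c powr q"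
    by (rule Youngs_inequality_0) (use assms False in auto)
  moreover have "(f powr q) powr (1/q) = f"
    using assms False by (simp add: powr_powr)
  moreover have "(c powr q) powr (1 - 1/q) = c powr (q - 1)"
    using assms by (simp add: powr_powr right_diff_distrib)
  ultimately have "q * (f * c powr (q - 1)) \<le> q * ((1/q) * f powr q + (1 - 1/q) * c powr q)"
    using assms by (intro mult_left_mono) auto
  also have "\<dots> = f powr q + (q - 1) * c powr q" using assms by (simp add: field_simps)
  finally show ?thesis by (simp add: mult_ac)
qed (use assms in auto)

text \<open>Jensen's inequality for \<open>\<lambda>f. f powr q\<close>, solved for the integral of \<open>f\<close>. Finiteness of
  that integral is part of the conclusion. The proof integrates the tangent inequality at
  \<open>c = (B / m) powr (1/q)\<close>, the value for which a constant function attains equality.\<close>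

lemma nn_integral_le_powr_mean:
  fixes f :: "'b \<Rightarrow> real"
  assumes [measurable]: "f \<in> borel_measurable M" and "\<And>x. 0 \<le> f x" and "1 \<le> q"
    and mass: "emeasure M (space M) = ennreal m" "0 < m"
    and B: "(\<integral>\<^sup>+x. ennreal (f x powr q) \<partial>M) = ennreal B" "0 \<le> B"
  shows "(\<integral>\<^sup>+x. ennreal (f x) \<partial>M) \<le> ennreal (m powr (1 - 1/q) * B powr (1/q))"
proof (cases "B = 0")
  case True
  then have "(\<integral>\<^sup>+x. ennreal (f x powr q) \<partial>M) = 0" using B by simp
  then have "AE x in M. ennreal (f x powr q) = 0"
    by (simp add: nn_integral_0_iff_AE)
  then have "AE x in M. ennreal (f x) = 0"
    by eventually_elim (use assms(2) in \<open>auto simp: ennreal_eq_0_iff\<close>)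
  then have "(\<integral>\<^sup>+x. ennreal (f x) \<partial>M) = 0"
    by (simp add: nn_integral_0_iff_AE)
  then show ?thesis by simp
next
  case False
  then have "0 < B" using B by simp
  define c where "c = (B / m) powr (1/q)"
  have c: "0 < c" "c powr q = B / m" "c powr (q - 1) = (B / m) powr (1 - 1/q)"
    using \<open>0 < B\<close> \<open>0 < m\<close> \<open>1 \<le> q\<close> by (auto simp: c_def powr_powr diff_divide_distrib)
  have "ennreal (q * c powr (q - 1)) * (\<integral>\<^sup>+x. ennreal (f x) \<partial>M)
      = (\<integral>\<^sup>+x. ennreal (q * c powr (q - 1) * f x) \<partial>M)"
    using assms c by (simp add: ennreal_mult nn_integral_cmult)
  also have "\<dots> \<le> (\<integral>\<^sup>+x. ennreal (f x powr q) + ennreal ((q - 1) * c powr q) \<partial>M)"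
    using powr_tangent_le[OF \<open>1 \<le> q\<close> assms(2) c(1)] \<open>1 \<le> q\<close>
    by (intro nn_integral_mono) (subst ennreal_plus[symmetric], auto intro: ennreal_leI simp del: ennreal_plus)
  also have "\<dots> = ennreal B + ennreal ((q - 1) * c powr q) * ennreal m"
    using B mass by (simp add: nn_integral_add)
  also have "\<dots> = ennreal (B + (q - 1) * c powr q * m)"
    using c \<open>0 < B\<close> \<open>0 < m\<close> \<open>1 \<le> q\<close> by (subst ennreal_mult[symmetric]) auto
  also have "B + (q - 1) * c powr q * m = q * B"
    using c \<open>0 < m\<close> by (simp add: field_simps)
  also have "q * B = (q * c powr (q - 1)) * (m powr (1 - 1/q) * B powr (1/q))"
  proof -
    have "c powr (q - 1) * (m powr (1 - 1/q) * B powr (1/q)) = B powr (1 - 1/q) * B powr (1/q)"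
      using \<open>0 < B\<close> \<open>0 < m\<close> by (simp add: c powr_divide)
    also have "\<dots> = B" using \<open>0 < B\<close> by (simp add: powr_add[symmetric])
    finally show ?thesis by simp
  qed
  also have "ennreal \<dots> = ennreal (q * c powr (q - 1)) * ennreal (m powr (1 - 1/q) * B powr (1/q))"
    using \<open>1 \<le> q\<close> by (intro ennreal_mult) auto
  finally show ?thesis
    using \<open>0 < c\<close> \<open>1 \<le> q\<close>
    by (subst (asm) ennreal_mult_le_mult_iff) (auto simp: ennreal_eq_0_iff mult_le_0_iff)
qed

text \<open>The fundamental theorem of calculus along the segment from \<open>x\<close> to \<open>x + w\<close>.\<close>

lemma increment_le_line_integral:
  fixes u :: "'a::euclidean_space \<Rightarrow> real"
  assumes u: "\<And>x. (u has_derivative (\<lambda>h. h \<bullet> G x)) (at x)" and G: "continuous_on UNIV G"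
  shows "ennreal \<bar>u (x + w) - u x\<bar> \<le>
    ennreal (norm w) * (\<integral>\<^sup>+t. indicator {0..1} t * ennreal (norm (G (x + t *\<^sub>R w))) \<partial>lborel)"
proof -
  let ?f = "\<lambda>t. w \<bullet> G (x + t *\<^sub>R w)"
  have [measurable]: "G \<in> borel_measurable borel" using G by (rule borel_measurable_continuous_onI)
  have der: "((\<lambda>t. u (x + t *\<^sub>R w)) has_vector_derivative ?f t) (at t within {0..1})" for t
  proof -
    have "((\<lambda>t. x + t *\<^sub>R w) has_derivative (\<lambda>h. h *\<^sub>R w)) (at t)"
      by (auto intro!: derivative_eq_intros)
    from diff_chain_at[OF this u[of "x + t *\<^sub>R w"]] show ?thesis
      by (auto simp: has_vector_derivative_def o_def intro: has_derivative_at_withinI)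
  qed
  have cont: "continuous_on {0..1} ?f"
    by (intro continuous_intros continuous_on_compose2[OF G]) auto
  note bi = has_bochner_integral_FTC_Icc[OF _ der cont]
  have "ennreal \<bar>u (x + w) - u x\<bar> = ennreal (norm (LINT t|lborel. indicator {0..1} t *\<^sub>R ?f t))"
    using has_bochner_integral_integral_eq[OF bi] by simp
  also have "\<dots> \<le> (\<integral>\<^sup>+t. ennreal (norm (indicator {0..1} t *\<^sub>R ?f t)) \<partial>lborel)"
    using bi by (intro integral_norm_bound_ennreal) (auto simp: has_bochner_integral_iff)
  also have "\<dots> \<le> (\<integral>\<^sup>+t. ennreal (norm w) * (indicator {0..1} t * ennreal (norm (G (x + t *\<^sub>R w)))) \<partial>lborel)"
  proof (intro nn_integral_mono)
    fix t :: real
    have "ennreal \<bar>?f t\<bar> \<le> ennreal (norm w) * ennreal (norm (G (x + t *\<^sub>R w)))"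
      by (subst ennreal_mult[symmetric]) (auto intro!: ennreal_leI Cauchy_Schwarz_ineq2)
    then show "ennreal (norm (indicator {0..1} t *\<^sub>R ?f t))
        \<le> ennreal (norm w) * (indicator {0..1} t * ennreal (norm (G (x + t *\<^sub>R w))))"
      by (auto simp: indicator_def)
  qed
  also have "\<dots> = ennreal (norm w) * (\<integral>\<^sup>+t. indicator {0..1} t * ennreal (norm (G (x + t *\<^sub>R w))) \<partial>lborel)"
    by (rule nn_integral_cmult) measurable
  finally show ?thesis .
qed

text \<open>At the points \<open>x + w\<close> where \<open>u\<close> vanishes, the increment of \<open>u\<close> from \<open>x\<close> is \<open>u x\<close> up to sign. Averaging the
  bound for the increment over these \<open>w\<close>, and enlarging the domain of integration on the right to the whole ball, bounds
  \<open>u x\<close> by averages of the gradient.\<close>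

lemma value_le_averaged_gradient:
  fixes u :: "'a::euclidean_space \<Rightarrow> real"
  assumes u: "\<And>x. (u has_derivative (\<lambda>h. h \<bullet> G x)) (at x)" and G: "continuous_on UNIV G"
    and \<sigma>: "ennreal \<sigma> \<le> emeasure lborel {w \<in> ball 0 d. u (x + w) = 0}" "0 \<le> \<sigma>" and "0 < d"
  shows "ennreal (\<sigma> * \<bar>u x\<bar>) \<le> ennreal d * (\<integral>\<^sup>+t. indicator {0..1} t *
    (\<integral>\<^sup>+w. indicator (ball 0 d) w * ennreal (norm (G (x + t *\<^sub>R w))) \<partial>lborel) \<partial>lborel)"
proof -
  define K where "K = ball (0::'a) d"
  have K: "ball 0 d = K" and [measurable]: "K \<in> sets borel" by (auto simp: K_def)
  have [measurable]: "G \<in> borel_measurable borel" using G by (rule borel_measurable_continuous_onI)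
  have "continuous_on UNIV u"
    using u by (intro continuous_at_imp_continuous_on) (auto intro: has_derivative_continuous)
  then have [measurable]: "u \<in> borel_measurable borel" by (rule borel_measurable_continuous_onI)
  let ?Z = "{w \<in> K. u (x + w) = 0}"
  let ?g = "\<lambda>t w. ennreal (norm (G (x + t *\<^sub>R w)))"
  have [measurable]: "?Z \<in> sets borel" by measurable
  have "ennreal (\<sigma> * \<bar>u x\<bar>) = ennreal \<sigma> * ennreal \<bar>u x\<bar>"
    using \<sigma> by (simp add: ennreal_mult)
  also have "\<dots> \<le> emeasure lborel ?Z * ennreal \<bar>u x\<bar>"
    using \<sigma> K by (intro mult_right_mono) auto
  also have "\<dots> = (\<integral>\<^sup>+w. indicator ?Z w * ennreal \<bar>u x\<bar> \<partial>lborel)"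
    by (simp add: nn_integral_multc)
  also have "\<dots> \<le> (\<integral>\<^sup>+w. ennreal d * (indicator (K) w * (\<integral>\<^sup>+t. indicator {0..1} t * ?g t w \<partial>lborel)) \<partial>lborel)"
  proof (intro nn_integral_mono)
    fix w :: 'a
    show "indicator ?Z w * ennreal \<bar>u x\<bar> \<le>
        ennreal d * (indicator (K) w * (\<integral>\<^sup>+t. indicator {0..1} t * ?g t w \<partial>lborel))"
    proof (cases "w \<in> ?Z")
      case True
      then have "ennreal \<bar>u x\<bar> \<le> ennreal (norm w) * (\<integral>\<^sup>+t. indicator {0..1} t * ?g t w \<partial>lborel)"
        using increment_le_line_integral[OF u G, of x w] by simp
      also have "\<dots> \<le> ennreal d * (\<integral>\<^sup>+t. indicator {0..1} t * ?g t w \<partial>lborel)"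
        using True by (intro mult_right_mono) (auto simp: K_def intro: ennreal_leI)
      finally show ?thesis using True by simp
    qed auto
  qed
  also have "\<dots> = ennreal d * (\<integral>\<^sup>+w. (\<integral>\<^sup>+t. indicator (K) w * (indicator {0..1} t * ?g t w) \<partial>lborel) \<partial>lborel)"
  proof -
    have inner: "(\<integral>\<^sup>+t. indicator (K) w * (indicator {0..1} t * ?g t w) \<partial>lborel)
        = indicator (K) w * (\<integral>\<^sup>+t. indicator {0..1} t * ?g t w \<partial>lborel)" for w
      by (rule nn_integral_cmult) measurable
    have "(\<lambda>w. indicator (K) w * (\<integral>\<^sup>+t. indicator {0..1} t * ?g t w \<partial>lborel))
        \<in> borel_measurable lborel"
      by measurable
    from nn_integral_cmult[OF this] show ?thesis by (simp only: inner)
  qed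
  also have "(\<integral>\<^sup>+w. (\<integral>\<^sup>+t. indicator (K) w * (indicator {0..1} t * ?g t w) \<partial>lborel) \<partial>lborel)
      = (\<integral>\<^sup>+t. (\<integral>\<^sup>+w. indicator (K) w * (indicator {0..1} t * ?g t w) \<partial>lborel) \<partial>lborel)"
    by (rule lborel_pair.Fubini') measurable
  also have "\<dots> = (\<integral>\<^sup>+t. indicator {0..1} t * (\<integral>\<^sup>+w. indicator (K) w * ?g t w \<partial>lborel) \<partial>lborel)"
    by (intro nn_integral_cong, subst nn_integral_cmult[symmetric]) (auto simp: mult_ac)
  finally show ?thesis unfolding K .
qed

lemma nn_integral_powr_unit_interval:
  assumes "b < 1"
  shows "(\<integral>\<^sup>+t. ennreal (t powr (- b)) * indicator {0<..1} t \<partial>lborel) = ennreal (1 / (1 - b))"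
proof -
  have "((\<lambda>t. t powr (- b)) has_integral (1 powr (- b + 1) / (- b + 1))) {0..1}"
    by (rule has_integral_powr_from_0) (use assms in auto)
  then have "(\<integral>\<^sup>+t. ennreal (t powr (- b)) * indicator {0..1} t \<partial>lborel) = ennreal (1 / (1 - b))"
    by (subst nn_integral_has_integral_lebesgue') auto
  moreover have "(\<integral>\<^sup>+t. ennreal (t powr (- b)) * indicator {0<..1} t \<partial>lborel)
      = (\<integral>\<^sup>+t. ennreal (t powr (- b)) * indicator {0..1} t \<partial>lborel)"
    by (intro nn_integral_cong) (auto simp: indicator_def)
  ultimately show ?thesis by simp
qed

section \<open>The subcritical Sobolev estimate\<close>

lemma nn_integral_weighted_le_powr_mean:
  fixes f :: "'b \<Rightarrow> real"
  assumes [measurable]: "f \<in> borel_measurable M" "W \<in> borel_measurable M"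
    and f: "\<And>x. 0 \<le> f x" and q: "1 \<le> q"
    and W: "(\<integral>\<^sup>+x. W x \<partial>M) = ennreal m" "0 < m"
    and B: "(\<integral>\<^sup>+x. W x * ennreal (f x powr q) \<partial>M) = ennreal B" "0 \<le> B"
  shows "(\<integral>\<^sup>+x. W x * ennreal (f x) \<partial>M) \<le> ennreal (m powr (1 - 1/q) * B powr (1/q))"
proof -
  have "emeasure (density M W) (space (density M W)) = ennreal m"
    using W by (simp add: emeasure_density cong: nn_integral_cong)
  then show ?thesis
    using nn_integral_le_powr_mean[of f "density M W" q m B] f q W B
    by (simp add: nn_integral_density)
qed

text \<open>
  Let \<open>H x t\<close> be the integral of \<open>\<bar>G (x + t w)\<bar> powr p\<close> over \<open>w\<close> in the ball \<open>K\<close> of radius \<open>d\<close>. The substitution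
  \<open>z = x + t w\<close> gives \<open>H x t \<le> t powr (-N) \<Gamma>\<close>. Hoelder's inequality in \<open>w\<close> bounds the integral of
  \<open>\<bar>G (x + t w)\<bar>\<close> by \<open>(H x t) powr (1/p)\<close>; of this power, \<open>1/p - 1/q\<close> is spent on the uniform bound, which
  costs the factor \<open>t powr (-b)\<close>, and only \<open>(H x t) powr (1/q)\<close> is kept. Hoelder's inequality in \<open>t\<close> for the
  weight \<open>t powr (-b)\<close>, of total mass \<open>m\<close>, then bounds \<open>\<bar>u x\<bar> powr q\<close> by the weighted integral \<open>J x\<close> of \<open>H x\<close>.
  Finally, \<open>H x t\<close> has integral at most \<open>v \<Gamma>\<close> in \<open>x\<close> for every \<open>t\<close>, by translation invariance.

  The bound \<open>\<Gamma>\<close> is an arbitrary positive majorant, so that a vanishing gradient integral causes no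
  degenerate case.
\<close>

lemma subcritical_sobolev_estimate:
  fixes u :: "'a::euclidean_space \<Rightarrow> real"
  assumes u: "\<And>x. (u has_derivative (\<lambda>h. h \<bullet> G x)) (at x)" and G: "continuous_on UNIV G"
    and p: "1 \<le> p" "p \<le> q" and b: "b = real DIM('a) * (1/p - 1/q)" "b < 1"
    and d: "0 < d" and \<sigma>: "0 < \<sigma>"
      "\<And>x. ennreal \<sigma> \<le> emeasure lborel {w \<in> ball 0 d. u (x + w) = 0}"
    and \<Gamma>: "0 < \<Gamma>" "(\<integral>\<^sup>+x. ennreal (norm (G x) powr p) \<partial>lborel) \<le> ennreal \<Gamma>"
    and v: "v = measure lborel (ball (0::'a) d)" and m: "m = 1 / (1 - b)"
  shows "(\<integral>\<^sup>+x. ennreal (\<bar>u x\<bar> powr q) \<partial>lborel) \<le>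
    ennreal ((d / \<sigma> * v powr (1 - 1/p) * \<Gamma> powr (1/p - 1/q) * m powr (1 - 1/q)) powr q * (m * v * \<Gamma>))"
proof -
  define K where "K = ball (0::'a) d"
  have [measurable]: "K \<in> sets borel" by (simp add: K_def)
  have [measurable]: "G \<in> borel_measurable borel" using G by (rule borel_measurable_continuous_onI)
  have vK: "emeasure lborel K = ennreal v" and "0 < v" and "0 < m"
    using emeasure_lborel_ball_finite[of "0::'a" d] content_ball_pos[OF d] b
    by (auto simp: K_def v m emeasure_eq_ennreal_measure)
  define h where "h x = ennreal (norm (G x) powr p)" for x
  have [measurable]: "h \<in> borel_measurable borel" unfolding h_def by measurable
  define H where "H x t = (\<integral>\<^sup>+w. indicator K w * h (x + t *\<^sub>R w) \<partial>lborel)" for x and t :: real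
  have [measurable]: "(\<lambda>(x, t). H x t) \<in> borel_measurable (borel \<Otimes>\<^sub>M borel)"
    unfolding H_def by measurable
  define W where "W t = ennreal (t powr (- b)) * indicator {0<..1} t" for t :: real
  have [measurable]: "W \<in> borel_measurable borel" unfolding W_def by measurable
  have massW: "(\<integral>\<^sup>+t. W t \<partial>lborel) = ennreal m"
    using nn_integral_powr_unit_interval[OF b(2)] by (simp add: W_def m)
  define J where "J x = (\<integral>\<^sup>+t. W t * H x t \<partial>lborel)" for x
  have [measurable]: "J \<in> borel_measurable borel"
    unfolding J_def by measurable
  define C where "C = d / \<sigma> * v powr (1 - 1/p) * \<Gamma> powr (1/p - 1/q) * m powr (1 - 1/q)"
  have "0 < C" using d \<sigma> \<open>0 < v\<close> \<open>0 < m\<close> \<Gamma> by (simp add: C_def)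

  have H_le: "H x t \<le> ennreal (t powr (- real DIM('a)) * \<Gamma>)" if "0 < t" for x t
  proof -
    have "H x t \<le> (\<integral>\<^sup>+w. h (x + t *\<^sub>R w) \<partial>lborel)"
      unfolding H_def by (intro nn_integral_mono) (auto simp: indicator_def)
    also have "\<dots> = ennreal (t powr (- real DIM('a))) * (\<integral>\<^sup>+w. h w \<partial>lborel)"
      using that by (intro nn_integral_lborel_scale) auto
    also have "\<dots> \<le> ennreal (t powr (- real DIM('a))) * ennreal \<Gamma>"
      using \<Gamma> unfolding h_def by (intro mult_left_mono) auto
    finally show ?thesis using \<Gamma> by (simp add: ennreal_mult)
  qed

  have slice: "(\<integral>\<^sup>+w. indicator K w * ennreal (norm (G (x + t *\<^sub>R w))) \<partial>lborel)
      \<le> ennreal (v powr (1 - 1/p) * \<Gamma> powr (1/p - 1/q)) *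
        (ennreal (t powr (- b)) * ennreal (enn2real (H x t) powr (1/q)))"
    if "0 < t" for x t
  proof -
    define R where "R = enn2real (H x t)"
    have "H x t < \<infinity>" using H_le[OF that, of x] by (rule le_less_trans) simp
    then have R: "H x t = ennreal R" "0 \<le> R" by (auto simp: R_def)
    then have R_le: "R \<le> t powr (- real DIM('a)) * \<Gamma>"
      using H_le[OF that, of x] \<Gamma> by simp
    have "(\<integral>\<^sup>+w. indicator K w * ennreal (norm (G (x + t *\<^sub>R w))) \<partial>lborel)
        \<le> ennreal (v powr (1 - 1/p) * R powr (1/p))"
      by (rule nn_integral_weighted_le_powr_mean)
        (use p vK \<open>0 < v\<close> R in \<open>auto simp: H_def h_def\<close>)
    also have "\<dots> \<le> ennreal (v powr (1 - 1/p) * ((t powr (- b) * \<Gamma> powr (1/p - 1/q)) * R powr (1/q)))"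
    proof (intro ennreal_leI mult_left_mono)
      \<comment> \<open>Only the first factor is estimated by the uniform bound; the second keeps the dependence on \<open>x\<close>.\<close>
      have "R powr (1/p) = R powr (1/p - 1/q) * R powr (1/q)"
        by (simp add: powr_add[symmetric])
      also have "R powr (1/p - 1/q) \<le> (t powr (- real DIM('a)) * \<Gamma>) powr (1/p - 1/q)"
        using R R_le p by (intro powr_mono2) (auto simp: frac_le)
      also have "\<dots> = t powr (- b) * \<Gamma> powr (1/p - 1/q)"
        using that \<Gamma> by (simp add: powr_mult powr_powr b)
      finally show "R powr (1/p) \<le> t powr (- b) * \<Gamma> powr (1/p - 1/q) * R powr (1/q)"
        by (simp add: mult_right_mono)
    qed auto
    finally show ?thesis
      by (simp add: R_def ennreal_mult[symmetric] mult_ac)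
  qed

  have pointwise: "ennreal (\<bar>u x\<bar> powr q) \<le> ennreal (C powr q) * J x" for x
  proof (cases "J x = \<infinity>")
    case True
    then show ?thesis using \<open>0 < C\<close> by (simp add: ennreal_mult_top)
  next
    case False
    define j where "j = enn2real (J x)"
    have j: "J x = ennreal j" "0 \<le> j" using False by (auto simp: j_def less_top)
    have J: "(\<integral>\<^sup>+t. W t * ennreal ((enn2real (H x t) powr (1/q)) powr q) \<partial>lborel) = ennreal j"
    proof -
      have "W t * ennreal ((enn2real (H x t) powr (1/q)) powr q) = W t * H x t" for t
      proof (cases "0 < t")
        case True
        then have "H x t < \<infinity>" using H_le[of t x] by (auto intro: le_less_trans)
        then show ?thesis using p by (simp add: powr_powr)
      qed (simp add: W_def)
      then show ?thesis by (simp add: j(1)[symmetric] J_def)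
    qed
    have "ennreal (\<sigma> * \<bar>u x\<bar>) \<le> ennreal d * (\<integral>\<^sup>+t. indicator {0..1} t *
        (\<integral>\<^sup>+w. indicator K w * ennreal (norm (G (x + t *\<^sub>R w))) \<partial>lborel) \<partial>lborel)"
      unfolding K_def using d \<sigma> by (intro value_le_averaged_gradient u G) auto
    also have "\<dots> \<le> ennreal d * (\<integral>\<^sup>+t. ennreal (v powr (1 - 1/p) * \<Gamma> powr (1/p - 1/q)) *
        (W t * ennreal (enn2real (H x t) powr (1/q))) \<partial>lborel)"
    proof (intro mult_left_mono nn_integral_mono_AE)
      \<comment> \<open>The weight \<open>W\<close> is \<open>0\<close> at \<open>t = 0\<close>, so the comparison can fail at this one point.\<close>
      have "AE t in lborel. t \<noteq> (0::real)" by (rule AE_lborel_singleton)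
      then show "AE t in lborel. indicator {0..1} t *
          (\<integral>\<^sup>+w. indicator K w * ennreal (norm (G (x + t *\<^sub>R w))) \<partial>lborel)
          \<le> ennreal (v powr (1 - 1/p) * \<Gamma> powr (1/p - 1/q)) *
            (W t * ennreal (enn2real (H x t) powr (1/q)))"
        by eventually_elim (use slice in \<open>auto simp: W_def indicator_def\<close>)
    qed auto
    also have "\<dots> = ennreal d * (ennreal (v powr (1 - 1/p) * \<Gamma> powr (1/p - 1/q)) *
        (\<integral>\<^sup>+t. W t * ennreal (enn2real (H x t) powr (1/q)) \<partial>lborel))"
      by (subst nn_integral_cmult) auto
    also have "\<dots> \<le> ennreal d * (ennreal (v powr (1 - 1/p) * \<Gamma> powr (1/p - 1/q)) *
        ennreal (m powr (1 - 1/q) * j powr (1/q)))"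
      by (intro mult_left_mono nn_integral_weighted_le_powr_mean)
        (use p massW \<open>0 < m\<close> J j in auto)
    also have "\<dots> = ennreal (\<sigma> * (C * j powr (1/q)))"
      using d \<sigma> by (simp add: ennreal_mult[symmetric] C_def mult_ac)
    finally have "\<sigma> * \<bar>u x\<bar> \<le> \<sigma> * (C * j powr (1/q))"
      using \<sigma> \<open>0 < C\<close> by (subst (asm) ennreal_le_iff) auto
    then have "\<bar>u x\<bar> \<le> C * j powr (1/q)" using \<sigma> by simp
    then have "\<bar>u x\<bar> powr q \<le> (C * j powr (1/q)) powr q"
      using p by (intro powr_mono2) auto
    also have "\<dots> = C powr q * j"
      using \<open>0 < C\<close> j p by (simp add: powr_mult powr_powr)
    finally show ?thesis
      using j by (simp add: ennreal_mult[symmetric] ennreal_leI)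
  qed

  have "(\<integral>\<^sup>+x. J x \<partial>lborel) = (\<integral>\<^sup>+t. (\<integral>\<^sup>+x. W t * H x t \<partial>lborel) \<partial>lborel)"
    unfolding J_def by (rule lborel_pair.Fubini') measurable
  also have "\<dots> = (\<integral>\<^sup>+t. W t * (\<integral>\<^sup>+x. H x t \<partial>lborel) \<partial>lborel)"
    by (intro nn_integral_cong nn_integral_cmult) measurable
  also have "\<dots> \<le> (\<integral>\<^sup>+t. W t * ennreal (v * \<Gamma>) \<partial>lborel)"
  proof (intro nn_integral_mono mult_left_mono)
    fix t :: real
    have "(\<integral>\<^sup>+x. H x t \<partial>lborel) = (\<integral>\<^sup>+w. (\<integral>\<^sup>+x. indicator K w * h (x + t *\<^sub>R w) \<partial>lborel) \<partial>lborel)"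
      unfolding H_def by (rule lborel_pair.Fubini') measurable
    also have "\<dots> = (\<integral>\<^sup>+w. indicator K w * (\<integral>\<^sup>+x. h x \<partial>lborel) \<partial>lborel)"
      by (intro nn_integral_cong) (simp add: nn_integral_cmult nn_integral_lborel_translation)
    also have "\<dots> = ennreal v * (\<integral>\<^sup>+x. h x \<partial>lborel)"
      by (simp add: nn_integral_multc vK)
    also have "\<dots> \<le> ennreal v * ennreal \<Gamma>"
      using \<Gamma> unfolding h_def by (intro mult_left_mono) auto
    finally show "(\<integral>\<^sup>+x. H x t \<partial>lborel) \<le> ennreal (v * \<Gamma>)"
      using \<open>0 < v\<close> \<Gamma> by (simp add: ennreal_mult)
  qed auto
  also have "\<dots> = ennreal (m * v * \<Gamma>)"
    using \<open>0 < v\<close> \<open>0 < m\<close> \<Gamma> by (simp add: nn_integral_multc massW ennreal_mult[symmetric] mult_ac)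
  finally have intJ: "(\<integral>\<^sup>+x. J x \<partial>lborel) \<le> ennreal (m * v * \<Gamma>)" .

  have "(\<integral>\<^sup>+x. ennreal (\<bar>u x\<bar> powr q) \<partial>lborel) \<le> (\<integral>\<^sup>+x. ennreal (C powr q) * J x \<partial>lborel)"
    by (intro nn_integral_mono pointwise)
  also have "\<dots> = ennreal (C powr q) * (\<integral>\<^sup>+x. J x \<partial>lborel)"
    by (rule nn_integral_cmult) measurable
  also have "\<dots> \<le> ennreal (C powr q) * ennreal (m * v * \<Gamma>)"
    using intJ by (intro mult_left_mono) auto
  also have "\<dots> = ennreal (C powr q * (m * v * \<Gamma>))"
    by (simp add: ennreal_mult')
  finally show ?thesis by (simp add: C_def)
qed

section \<open>Test functions and scaling\<close>

lemma continuous_compact_support_integrable: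
  fixes f :: "'a::euclidean_space \<Rightarrow> real"
  assumes "continuous_on UNIV f" "compact K" "\<And>x. x \<notin> K \<Longrightarrow> f x = 0"
  shows "integrable lborel f"
proof -
  have "integrable lborel (\<lambda>x. indicator K x *\<^sub>R f x)"
    using assms by (intro borel_integrable_compact) (auto intro: continuous_on_subset)
  moreover have "(\<lambda>x. indicator K x *\<^sub>R f x) = f"
    using assms(3) by (auto simp: fun_eq_iff indicator_def)
  ultimately show ?thesis by simp
qed

lemma set_lebesgue_integral_eq_whole:
  fixes f :: "'a::euclidean_space \<Rightarrow> real"
  assumes "\<And>x. x \<notin> \<Omega> \<Longrightarrow> f x = 0"
  shows "(LINT x:\<Omega>|lborel. f x) = (LINT x|lborel. f x)"
  unfolding set_lebesgue_integral_def
  by (intro Bochner_Integration.integral_cong) (use assms in \<open>auto simp: indicator_def\<close>)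

context
  fixes \<phi> :: "'a::euclidean_space \<Rightarrow> real" and \<Omega> :: "'a set"
  assumes test: "\<phi> \<in> test_functions \<Omega>"
begin

lemma test_function_Ck: "Ck k \<phi>"
  using test by (simp add: test_functions_def smooth_def)

lemma test_function_differentiable: "\<phi> differentiable (at x)"
  using test_function_Ck[of 1] by simp

lemma test_function_has_gradient: "(\<phi> has_derivative (\<lambda>h. h \<bullet> gradient \<phi> x)) (at x)"
  using gderiv_gradient[OF test_function_differentiable] by (simp add: gderiv_def)

lemma test_function_continuous: "continuous_on A \<phi>"
  using test_function_Ck[of 0] continuous_on_subset by auto

lemma test_function_gradient_continuous: "continuous_on A (gradient \<phi>)"
proof -
  have "continuous_on A (\<lambda>x. frechet_derivative \<phi> (at x) v)" for v
    using test_function_Ck[of 1] by (auto intro: continuous_on_subset)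
  then show ?thesis
    unfolding gradient_def[abs_def] by (intro continuous_intros)
qed

lemma test_function_zero_outside: "x \<notin> \<Omega> \<Longrightarrow> \<phi> x = 0"
  using test closure_subset[of "{x. \<phi> x \<noteq> 0}"] by (auto simp: test_functions_def)

lemma test_function_gradient_zero_outside_support:
  assumes "x \<notin> closure {x. \<phi> x \<noteq> 0}"
  shows "gradient \<phi> x = 0"
proof -
  have "((\<lambda>x. 0) has_derivative (\<lambda>h. 0)) (at x)" by simp
  then have "(\<phi> has_derivative (\<lambda>h. 0)) (at x)"
    by (rule has_derivative_transform_within_open[where s="- closure {x. \<phi> x \<noteq> 0}"])
      (use assms closure_subset[of "{x. \<phi> x \<noteq> 0}"] in auto)
  from frechet_derivative_at[OF this] show ?thesis
    by (simp add: gradient_def fun_eq_iff)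
qed

lemma test_function_gradient_zero_outside: "x \<notin> \<Omega> \<Longrightarrow> gradient \<phi> x = 0"
  using test by (intro test_function_gradient_zero_outside_support) (auto simp: test_functions_def)

lemma test_function_integrable_powr:
  assumes "1 \<le> q"
  shows "integrable lborel (\<lambda>x. \<bar>\<phi> x\<bar> powr q)"
  by (rule continuous_compact_support_integrable[where K="closure {x. \<phi> x \<noteq> 0}"])
    (use test assms closure_subset[of "{x. \<phi> x \<noteq> 0}"] in
      \<open>auto simp: test_functions_def intro!: continuous_intros continuous_on_powr' test_function_continuous\<close>)

lemma test_function_gradient_integrable_powr:
  assumes "1 \<le> p"
  shows "integrable lborel (\<lambda>x. norm (gradient \<phi> x) powr p)"
  by (rule continuous_compact_support_integrable[where K="closure {x. \<phi> x \<noteq> 0}"])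
    (use test assms test_function_gradient_zero_outside_support in
      \<open>auto simp: test_functions_def intro!: continuous_intros continuous_on_powr' test_function_gradient_continuous\<close>)

lemma test_function_set_integral:
  assumes "1 \<le> q"
  shows "ennreal (LINT x:\<Omega>|lborel. \<bar>\<phi> x\<bar> powr q) = (\<integral>\<^sup>+x. ennreal (\<bar>\<phi> x\<bar> powr q) \<partial>lborel)"
  using assms test_function_zero_outside
  by (subst set_lebesgue_integral_eq_whole)
    (auto intro!: nn_integral_eq_integral[symmetric] test_function_integrable_powr)

lemma test_function_gradient_set_integral:
  assumes "1 \<le> p"
  shows "ennreal (LINT x:\<Omega>|lborel. norm (gradient \<phi> x) powr p)
    = (\<integral>\<^sup>+x. ennreal (norm (gradient \<phi> x) powr p) \<partial>lborel)"
  using assms test_function_gradient_zero_outside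
  by (subst set_lebesgue_integral_eq_whole)
    (auto intro!: nn_integral_eq_integral[symmetric] test_function_gradient_integrable_powr)

text \<open>The normalisation and the energy are rewritten as integrals over the whole space with values in
  \<open>[0, \<infinity>]\<close>, which no longer mention \<open>\<Omega>\<close> and to which Tonelli's theorem and changes of variables apply
  without integrability conditions.\<close>

lemma Lq_norm_eq_1_iff:
  assumes "1 \<le> q"
  shows "Lq_norm q \<Omega> \<phi> = 1 \<longleftrightarrow> (\<integral>\<^sup>+x. ennreal (\<bar>\<phi> x\<bar> powr q) \<partial>lborel) = 1"
proof -
  define I where "I = (LINT x:\<Omega>|lborel. \<bar>\<phi> x\<bar> powr q)"
  have "0 \<le> I" unfolding I_def set_lebesgue_integral_def by (rule integral_nonneg_AE) auto
  have "I powr (1/q) = 1 \<longleftrightarrow> I = 1"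
  proof
    assume "I powr (1/q) = 1"
    then have "(I powr (1/q)) powr q = 1" by simp
    then show "I = 1" using assms \<open>0 \<le> I\<close> by (simp add: powr_powr)
  qed auto
  then show ?thesis
    unfolding test_function_set_integral[OF assms, symmetric] Lq_norm_def I_def[symmetric]
    using \<open>0 \<le> I\<close> by simp
qed

lemma gradient_rescaled:
  "gradient (\<lambda>x. s * \<phi> (a + c *\<^sub>R x)) x = (s * c) *\<^sub>R gradient \<phi> (a + c *\<^sub>R x)"
proof -
  have "((\<lambda>x. s * \<phi> (a + c *\<^sub>R x)) has_derivative
      (\<lambda>v. s * (c * frechet_derivative \<phi> (at (a + c *\<^sub>R x)) v))) (at x)"
    by (intro has_derivative_mult_right has_derivative_compose_affine test_function_differentiable)
  from frechet_derivative_at[OF this, symmetric] show ?thesis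
    by (simp add: gradient_def scaleR_sum_right mult_ac)
qed

lemma rescaled_test_function:
  assumes "0 < c" and "\<And>x. a + c *\<^sub>R x \<in> \<Omega> \<Longrightarrow> x \<in> \<Omega>'"
  shows "(\<lambda>x. s * \<phi> (a + c *\<^sub>R x)) \<in> test_functions \<Omega>'"
proof -
  define S where "S = closure {x. \<phi> x \<noteq> 0}"
  define T where "T = (\<lambda>y. (1/c) *\<^sub>R (y - a)) ` S"
  have S: "compact S" "S \<subseteq> \<Omega>" using test by (auto simp: S_def test_functions_def)
  then have T: "compact T"
    unfolding T_def by (intro compact_continuous_image continuous_intros)
  have "{x. s * \<phi> (a + c *\<^sub>R x) \<noteq> 0} \<subseteq> T"
  proof
    fix x assume "x \<in> {x. s * \<phi> (a + c *\<^sub>R x) \<noteq> 0}"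
    then have "a + c *\<^sub>R x \<in> S" unfolding S_def by (intro subsetD[OF closure_subset]) auto
    then show "x \<in> T" unfolding T_def using assms(1) by (intro image_eqI[of _ _ "a + c *\<^sub>R x"]) auto
  qed
  then have "closure {x. s * \<phi> (a + c *\<^sub>R x) \<noteq> 0} \<subseteq> T"
    by (rule closure_minimal) (use T compact_imp_closed in auto)
  moreover have "T \<subseteq> \<Omega>'"
    using S assms by (auto simp: T_def)
  moreover have "compact (closure {x. s * \<phi> (a + c *\<^sub>R x) \<noteq> 0})"
    using T calculation(1) bounded_subset compact_imp_bounded
    by (auto simp: compact_eq_bounded_closed)
  ultimately show ?thesis
    by (auto simp: test_functions_def smooth_def
        intro!: Ck_mult Ck_const Ck_compose_affine test_function_Ck)
qed

end

lemma poincare_sobolev_const_le: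
  assumes "\<phi> \<in> test_functions \<Omega>" "1 \<le> p" "1 \<le> q"
    and "(\<integral>\<^sup>+x. ennreal (\<bar>\<phi> x\<bar> powr q) \<partial>lborel) = 1"
  shows "poincare_sobolev_const p q \<Omega> \<le> (\<integral>\<^sup>+x. ennreal (norm (gradient \<phi> x) powr p) \<partial>lborel)"
  unfolding poincare_sobolev_const_def
  using assms by (intro INF_lower2[of \<phi>])
    (auto simp: Lq_norm_eq_1_iff test_function_gradient_set_integral)

lemma poincare_sobolev_const_ge:
  assumes "1 \<le> p" "1 \<le> q"
    and "\<And>\<phi>. \<phi> \<in> test_functions \<Omega> \<Longrightarrow> (\<integral>\<^sup>+x. ennreal (\<bar>\<phi> x\<bar> powr q) \<partial>lborel) = 1 \<Longrightarrow>
      C \<le> (\<integral>\<^sup>+x. ennreal (norm (gradient \<phi> x) powr p) \<partial>lborel)"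
  shows "C \<le> poincare_sobolev_const p q \<Omega>"
  unfolding poincare_sobolev_const_def
  using assms by (intro INF_greatest)
    (auto simp: Lq_norm_eq_1_iff test_function_gradient_set_integral)

lemma poincare_sobolev_const_unit_ball_finite:
  assumes "1 \<le> p" "1 \<le> q"
  shows "poincare_sobolev_const p q (ball (0::'a::euclidean_space) 1) < \<infinity>"
proof -
  define f where "f = (\<lambda>x::'a. flat 0 (1/4 - x \<bullet> x))"
  have f: "f \<in> test_functions (ball 0 1)" unfolding f_def by (rule flat_ball_test_function)
  define I where "I = (LINT x|lborel. \<bar>f x\<bar> powr q)"
  note int = test_function_integrable_powr[OF f assms(2)]
  have nnI: "(\<integral>\<^sup>+x. ennreal (\<bar>f x\<bar> powr q) \<partial>lborel) = ennreal I"
    unfolding I_def using int by (rule nn_integral_eq_integral) auto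
  have "I \<noteq> 0"
  proof
    assume "I = 0"
    then have "AE x in lborel. \<bar>f x\<bar> powr q = 0"
      unfolding I_def using integral_nonneg_eq_0_iff_AE[OF int] by auto
    then have "AE x in lborel. x \<notin> ball (0::'a) (1/2)"
    proof eventually_elim
      case (elim x)
      show ?case
      proof
        assume "x \<in> ball 0 (1/2)"
        then have "(norm x)\<^sup>2 < (1/2)\<^sup>2" by (intro power_strict_mono) auto
        then have "0 < 1/4 - x \<bullet> x" by (simp add: dot_square_norm power2_eq_square)
        then show False using elim by (simp add: f_def flat_def)
      qed
    qed
    then have "emeasure lborel (ball (0::'a) (1/2)) = 0"
      by (subst (asm) AE_iff_measurable[of "ball 0 (1/2)"]) auto
    then show False using content_ball_pos[of "1/2" "0::'a"] by (simp add: measure_def)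
  qed
  moreover have "0 \<le> I" unfolding I_def by (rule integral_nonneg_AE) auto
  ultimately have "0 < I" by simp
  define g where "g = (\<lambda>x. I powr (- 1/q) * f (0 + 1 *\<^sub>R x))"
  have g: "g \<in> test_functions (ball 0 1)"
    unfolding g_def by (rule rescaled_test_function[OF f]) auto
  have "(\<integral>\<^sup>+x. ennreal (\<bar>g x\<bar> powr q) \<partial>lborel)
      = (\<integral>\<^sup>+x. ennreal (1 / I) * ennreal (\<bar>f x\<bar> powr q) \<partial>lborel)"
    using assms \<open>0 < I\<close>
    by (intro nn_integral_cong)
      (simp add: g_def abs_mult powr_mult powr_powr ennreal_mult[symmetric] powr_minus powr_divide field_simps)
  also have "\<dots> = 1"
    using \<open>0 < I\<close> int by (subst nn_integral_cmult) (auto simp: nnI ennreal_mult[symmetric])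
  finally have "poincare_sobolev_const p q (ball (0::'a) 1)
      \<le> (\<integral>\<^sup>+x. ennreal (norm (gradient g x) powr p) \<partial>lborel)"
    using poincare_sobolev_const_le[OF g assms] by simp
  also have "\<dots> < \<infinity>"
    using nn_integral_eq_integral[OF test_function_gradient_integrable_powr[OF g assms(1)]] by simp
  finally show ?thesis .
qed

text \<open>A normalised test function \<open>\<phi>\<close> on the unit ball is transported to \<open>ball x0 r\<close> by
  \<open>\<psi> x = s \<phi> ((x - x0) / r)\<close>. The amplitude \<open>s = r powr (-N/q)\<close> keeps the \<open>L\<^sup>q\<close> norm equal to \<open>1\<close>, and the
  energy is multiplied by \<open>(s / r) powr p * r powr N = r powr (-\<alpha>)\<close>.\<close>

lemma poincare_sobolev_const_scaling:
  fixes \<Omega> :: "'a::euclidean_space set"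
  assumes "1 \<le> p" "1 \<le> q" "0 < r" "ball x0 r \<subseteq> \<Omega>"
  defines "\<alpha> \<equiv> p - real DIM('a) + real DIM('a) * p / q"
  shows "poincare_sobolev_const p q \<Omega> * ennreal (r powr \<alpha>) \<le> poincare_sobolev_const p q (ball (0::'a) 1)"
proof (rule poincare_sobolev_const_ge[OF assms(1,2)])
  fix \<phi> :: "'a \<Rightarrow> real"
  assume \<phi>: "\<phi> \<in> test_functions (ball 0 1)" and norm: "(\<integral>\<^sup>+x. ennreal (\<bar>\<phi> x\<bar> powr q) \<partial>lborel) = 1"
  define a where "a = - (1/r) *\<^sub>R x0"
  define s where "s = r powr (- real DIM('a) / q)"
  define \<psi> where "\<psi> = (\<lambda>x. s * \<phi> (a + (1/r) *\<^sub>R x))"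
  have [measurable]: "\<phi> \<in> borel_measurable borel" "gradient \<phi> \<in> borel_measurable borel"
    using test_function_continuous[OF \<phi>] test_function_gradient_continuous[OF \<phi>]
    by (auto intro: borel_measurable_continuous_onI)
  have "0 < s" using assms by (simp add: s_def)
  have \<psi>: "\<psi> \<in> test_functions \<Omega>"
    unfolding \<psi>_def
  proof (rule rescaled_test_function[OF \<phi>])
    fix x assume "a + (1/r) *\<^sub>R x \<in> ball 0 1"
    then have "norm ((1/r) *\<^sub>R (x - x0)) < 1" by (simp add: a_def algebra_simps)
    then have "x \<in> ball x0 r" using assms by (simp add: dist_norm norm_minus_commute)
    then show "x \<in> \<Omega>" using assms by auto
  qed (use assms in auto)
  have rN: "(1/r) powr (- real DIM('a)) = r powr real DIM('a)"
    using assms by (simp add: powr_divide powr_minus)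
  have "(\<integral>\<^sup>+x. ennreal (\<bar>\<psi> x\<bar> powr q) \<partial>lborel)
      = (\<integral>\<^sup>+x. ennreal (s powr q) * ennreal (\<bar>\<phi> (a + (1/r) *\<^sub>R x)\<bar> powr q) \<partial>lborel)"
    using \<open>0 < s\<close> by (simp add: \<psi>_def abs_mult powr_mult ennreal_mult)
  also have "\<dots> = ennreal (s powr q) * (ennreal (r powr real DIM('a)) * 1)"
    using assms rN norm nn_integral_lborel_scale[of "\<lambda>x. ennreal (\<bar>\<phi> x\<bar> powr q)" "1/r" a]
    by (simp add: nn_integral_cmult)
  also have "\<dots> = 1"
    using assms by (simp add: s_def powr_powr ennreal_mult[symmetric] powr_add[symmetric])
  finally have "poincare_sobolev_const p q \<Omega> \<le> (\<integral>\<^sup>+x. ennreal (norm (gradient \<psi> x) powr p) \<partial>lborel)"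
    by (rule poincare_sobolev_const_le[OF \<psi> assms(1,2)])
  also have "\<dots> = (\<integral>\<^sup>+x. ennreal ((s * (1/r)) powr p) * ennreal (norm (gradient \<phi> (a + (1/r) *\<^sub>R x)) powr p) \<partial>lborel)"
  proof -
    have "norm (gradient \<psi> x) = s * (1/r) * norm (gradient \<phi> (a + (1/r) *\<^sub>R x))" for x
      unfolding \<psi>_def gradient_rescaled[OF \<phi>] using \<open>0 < s\<close> assms by simp
    then have "norm (gradient \<psi> x) powr p = (s * (1/r)) powr p * norm (gradient \<phi> (a + (1/r) *\<^sub>R x)) powr p" for x
      using \<open>0 < s\<close> assms by (simp add: powr_mult powr_divide)
    then show ?thesis by (simp only: ennreal_mult' powr_ge_zero)
  qed
  also have "\<dots> = ennreal ((s * (1/r)) powr p) * (ennreal (r powr real DIM('a)) *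
      (\<integral>\<^sup>+x. ennreal (norm (gradient \<phi> x) powr p) \<partial>lborel))"
    using assms rN nn_integral_lborel_scale[of "\<lambda>x. ennreal (norm (gradient \<phi> x) powr p)" "1/r" a]
    by (simp add: nn_integral_cmult)
  also have "\<dots> = ennreal (r powr (- \<alpha>)) * (\<integral>\<^sup>+x. ennreal (norm (gradient \<phi> x) powr p) \<partial>lborel)"
  proof -
    have "s * (1/r) = r powr (- real DIM('a) / q - 1)"
      using assms by (simp add: s_def powr_diff)
    then have "(s * (1/r)) powr p * r powr real DIM('a) = r powr ((- real DIM('a) / q - 1) * p + real DIM('a))"
      by (simp only: powr_powr powr_add)
    also have "(- real DIM('a) / q - 1) * p + real DIM('a) = - \<alpha>"
      by (simp add: \<alpha>_def algebra_simps)
    finally have "(s * (1/r)) powr p * r powr real DIM('a) = r powr (- \<alpha>)" .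
    then show ?thesis
      by (simp add: mult.assoc[symmetric] ennreal_mult[symmetric])
  qed
  finally have "poincare_sobolev_const p q \<Omega> * ennreal (r powr \<alpha>)
      \<le> ennreal (r powr (- \<alpha>)) * (\<integral>\<^sup>+x. ennreal (norm (gradient \<phi> x) powr p) \<partial>lborel) * ennreal (r powr \<alpha>)"
    by (intro mult_right_mono) auto
  also have "\<dots> = (ennreal (r powr (- \<alpha>)) * ennreal (r powr \<alpha>)) *
      (\<integral>\<^sup>+x. ennreal (norm (gradient \<phi> x) powr p) \<partial>lborel)"
    by (simp add: mult_ac)
  also have "ennreal (r powr (- \<alpha>)) * ennreal (r powr \<alpha>) = 1"
    using assms by (simp add: ennreal_mult[symmetric] powr_add[symmetric])
  finally show "poincare_sobolev_const p q \<Omega> * ennreal (r powr \<alpha>)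
      \<le> (\<integral>\<^sup>+x. ennreal (norm (gradient \<phi> x) powr p) \<partial>lborel)" by simp
qed

lemma emeasure_lborel_translated_vimage:
  fixes A :: "'a::euclidean_space set"
  assumes [measurable]: "A \<in> sets borel"
  shows "emeasure lborel {w. x + w \<in> A} = emeasure lborel A"
proof -
  have "emeasure lborel A = emeasure (distr lborel borel ((+) x)) A"
    by (simp add: lborel_distr_plus)
  also have "\<dots> = emeasure lborel {w. x + w \<in> A}"
    by (subst emeasure_distr) (auto simp: vimage_def)
  finally show ?thesis by simp
qed

text \<open>The Sobolev estimate is applied with \<open>d = 3 R\<close> and \<open>\<sigma> = s \<bar>B\<^sub>R\<bar>\<close>: a test function on \<open>\<Omega>\<close> vanishes on the
  complement of \<open>\<Omega>\<close>. The powers of \<open>R\<close> combine to \<open>R powr \<alpha>\<close>, so the constant depends on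
  \<open>\<Omega>\<close> only through \<open>s\<close>. Taking logarithms turns the bookkeeping of exponents into linear arithmetic;
  \<open>k\<close> collects the terms without \<open>R\<close> and \<open>\<Gamma>\<close>.\<close>

lemma poincare_sobolev_lower_bound:
  fixes p q s :: real
  defines "N \<equiv> real DIM('a::euclidean_space)"
  defines "\<alpha> \<equiv> p - N + N * p / q"
  assumes pq: "1 \<le> p" "p \<le> q" and \<alpha>: "0 < \<alpha>" and s: "0 < s"
  shows "\<exists>c>0. \<forall>(\<Omega>::'a set) R. open \<Omega> \<and> 0 < R \<and>
      (\<forall>x. s * measure lborel (ball x R) \<le> measure lborel (ball x (3 * R) - \<Omega>)) \<longrightarrow>
      ennreal (c / R powr \<alpha>) \<le> poincare_sobolev_const p q \<Omega>"
proof -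
  define \<beta> where "\<beta> = measure lborel (ball (0::'a) 1)"
  define b where "b = N * (1/p - 1/q)"
  define m where "m = 1 / (1 - b)"
  have "0 < \<beta>" by (simp add: \<beta>_def content_ball_pos)
  have "1 - b = \<alpha> / p" using pq by (simp add: b_def \<alpha>_def field_simps)
  then have "b < 1" using \<alpha> pq by (smt (verit) divide_pos_pos)
  then have "0 < m" by (simp add: m_def)
  define k where "k = p * (ln m + ln 3 - ln s - ln \<beta>) + (p - 1 + p/q) * (ln \<beta> + N * ln 3)"
  have ball: "measure lborel (ball x r) = \<beta> * r powr N" if "0 < r" for r and x :: 'a
    using content_ball_conv_unit_ball[of r x] that by (simp add: \<beta>_def N_def powr_realpow)
  have "ennreal (exp (- k) / R powr \<alpha>) \<le> poincare_sobolev_const p q \<Omega>"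
    if \<Omega>: "open \<Omega>" and R: "0 < R"
      and dens: "\<And>x. s * measure lborel (ball x R) \<le> measure lborel (ball x (3 * R) - \<Omega>)"
    for \<Omega> :: "'a set" and R
  proof (rule poincare_sobolev_const_ge)
    fix \<phi> assume \<phi>: "\<phi> \<in> test_functions \<Omega>" and norm: "(\<integral>\<^sup>+x. ennreal (\<bar>\<phi> x\<bar> powr q) \<partial>lborel) = 1"
    define d where "d = 3 * R"
    define \<sigma> where "\<sigma> = s * (\<beta> * R powr N)"
    define v where "v = measure lborel (ball (0::'a) d)"
    have pos: "0 < d" "0 < \<sigma>" "0 < v"
      using R s \<open>0 < \<beta>\<close> by (auto simp: d_def \<sigma>_def v_def intro: content_ball_pos)
    have lns: "ln d = ln 3 + ln R" "ln \<sigma> = ln s + ln \<beta> + N * ln R"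
        "ln v = ln \<beta> + N * (ln 3 + ln R)"
      using R s \<open>0 < \<beta>\<close> ball[OF pos(1), of 0]
      by (auto simp: d_def \<sigma>_def v_def ln_mult ln_powr powr_mult distrib_left)
    have \<sigma>_le: "ennreal \<sigma> \<le> emeasure lborel {w \<in> ball 0 d. \<phi> (x + w) = 0}" for x
    proof -
      have [measurable]: "\<Omega> \<in> sets borel" "ball x d \<in> sets borel" using \<Omega> by auto
      have [measurable]: "\<phi> \<in> borel_measurable borel"
        using test_function_continuous[OF \<phi>] by (rule borel_measurable_continuous_onI)
      have fin: "emeasure lborel (ball x d - \<Omega>) < \<infinity>"
        using emeasure_lborel_ball_finite[of x d]
        by (rule le_less_trans[OF emeasure_mono, rotated 2]) auto
      have "ennreal \<sigma> \<le> ennreal (measure lborel (ball x d - \<Omega>))"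
        using dens[of x] ball[OF R, of x] by (intro ennreal_leI) (simp add: \<sigma>_def d_def)
      also have "\<dots> = emeasure lborel (ball x d - \<Omega>)"
        using fin by (intro emeasure_eq_ennreal_measure[symmetric]) auto
      also have "\<dots> = emeasure lborel {w. x + w \<in> ball x d - \<Omega>}"
        by (rule emeasure_lborel_translated_vimage[symmetric]) measurable
      also have "\<dots> \<le> emeasure lborel {w \<in> ball 0 d. \<phi> (x + w) = 0}"
        by (rule emeasure_mono) (auto simp: dist_norm test_function_zero_outside[OF \<phi>])
      finally show ?thesis .
    qed
    have bound: "exp (- k) / R powr \<alpha> \<le> \<Gamma>"
      if \<Gamma>: "0 < \<Gamma>" "(\<integral>\<^sup>+x. ennreal (norm (gradient \<phi> x) powr p) \<partial>lborel) \<le> ennreal \<Gamma>" for \<Gamma>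
    proof -
      let ?C = "(d / \<sigma> * v powr (1 - 1/p) * \<Gamma> powr (1/p - 1/q) * m powr (1 - 1/q)) powr q * (m * v * \<Gamma>)"
      have "1 \<le> ennreal ?C"
        unfolding norm[symmetric]
        by (rule subcritical_sobolev_estimate[OF test_function_has_gradient[OF \<phi>]
              test_function_gradient_continuous[OF \<phi>] pq b_def[unfolded N_def] \<open>b < 1\<close>
              pos(1,2) \<sigma>_le \<Gamma> v_def m_def])
      then have "1 \<le> ?C" by simp
      then have "0 \<le> ln ?C" by simp
      also have "ln ?C = q * (ln d - ln \<sigma> + (1 - 1/p) * ln v + (1/p - 1/q) * ln \<Gamma> + (1 - 1/q) * ln m)
          + ln m + ln v + ln \<Gamma>"
        using pos \<Gamma> \<open>0 < m\<close> by (simp add: ln_mult ln_div ln_powr)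
      finally have "0 \<le> (p/q) * (q * (ln d - ln \<sigma> + (1 - 1/p) * ln v + (1/p - 1/q) * ln \<Gamma> + (1 - 1/q) * ln m)
          + ln m + ln v + ln \<Gamma>)"
        using pq by (intro mult_nonneg_nonneg) auto
      also have "\<dots> = k + \<alpha> * ln R + ln \<Gamma>"
        using pq by (simp add: lns k_def \<alpha>_def field_simps)
      finally have "exp (- k - \<alpha> * ln R) \<le> exp (ln \<Gamma>)" by simp
      then show ?thesis using R \<Gamma> by (simp add: exp_diff powr_def)
    qed
    show "ennreal (exp (- k) / R powr \<alpha>) \<le> (\<integral>\<^sup>+x. ennreal (norm (gradient \<phi> x) powr p) \<partial>lborel)"
    proof (rule ccontr)
      \<comment> \<open>The energy itself might be \<open>0\<close>; the midpoint of the energy and the claimed bound is an admissible \<open>\<Gamma>\<close>.\<close>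
      define e where "e = exp (- k) / R powr \<alpha>"
      have "0 < e" using R by (simp add: e_def)
      assume "\<not> ?thesis"
      then have less: "(\<integral>\<^sup>+x. ennreal (norm (gradient \<phi> x) powr p) \<partial>lborel) < ennreal e"
        by (simp add: e_def)
      then obtain g where g: "(\<integral>\<^sup>+x. ennreal (norm (gradient \<phi> x) powr p) \<partial>lborel) = ennreal g" "0 \<le> g"
        by (cases "\<integral>\<^sup>+x. ennreal (norm (gradient \<phi> x) powr p) \<partial>lborel") auto
      then have "g < e" using less by (simp add: ennreal_less_iff)
      then have "e \<le> (g + e) / 2"
        unfolding e_def by (intro bound) (use g \<open>0 < e\<close> in \<open>auto simp: e_def[symmetric] intro: ennreal_leI\<close>)
      with \<open>g < e\<close> show False by simp
    qed
  qed (use pq in auto)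
  then show ?thesis by (intro exI[of _ "exp (- k)"]) auto
qed

section \<open>Geometry of the inradius\<close>

lemma ball_subset_if_less_inradius:
  assumes "ennreal r < inradius \<Omega>"
  shows "\<exists>x0. ball x0 r \<subseteq> \<Omega>"
proof -
  obtain r' x0 where "ennreal r < ennreal r'" "ball x0 r' \<subseteq> \<Omega>"
    using assms by (auto simp: inradius_def less_Sup_iff)
  moreover from this have "r \<le> r'"
    by (meson ennreal_leI linear not_le)
  ultimately show ?thesis by (meson subset_ball order_trans)
qed

lemma le_inradius:
  "0 < r \<Longrightarrow> ball x0 r \<subseteq> \<Omega> \<Longrightarrow> ennreal r \<le> inradius \<Omega>"
  unfolding inradius_def by (intro Sup_upper) auto

text \<open>If \<open>ball x (2 R)\<close> misses the frontier, then, being connected and too large to lie in \<open>\<Omega>\<close>, it is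
  disjoint from \<open>\<Omega>\<close>. Otherwise it contains a frontier point \<open>y\<close>, and the density condition is used at \<open>y\<close> with radius
  \<open>min r0 R\<close>, which keeps the ball inside \<open>ball x (3 R)\<close>. This radius is at least \<open>min 1 \<kappa>1 * R\<close>, and
  \<open>r0\<close> exceeds it by at most the factor \<open>max 1 \<kappa>2\<close>; so \<open>\<kappa>2\<close> enters only through \<open>(max 1 \<kappa>2) powr (- t0)\<close>,
  which is \<open>1\<close> if \<open>t0 = 0\<close>.\<close>

lemma complement_density:
  fixes \<Omega> :: "'a::euclidean_space set"
  assumes \<Omega>: "open \<Omega>" "inradius \<Omega> = ennreal R" "0 < R"
    and index: "ennreal \<theta> \<le> density_index \<Omega> r0 t" "0 < \<theta>" "0 < r0" "0 \<le> t" "t \<le> t0"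
    and \<kappa>: "0 < \<kappa>1" "\<kappa>1 \<le> r0 / R" "r0 / R \<le> \<kappa>2"
  shows "min 1 (\<theta> * (min 1 \<kappa>1) ^ DIM('a) * (max 1 \<kappa>2) powr (- t0)) * measure lborel (ball x R)
    \<le> measure lborel (ball x (3 * R) - \<Omega>)"
proof -
  define \<beta> where "\<beta> = measure lborel (ball (0::'a) 1)"
  have "0 < \<beta>" by (simp add: \<beta>_def content_ball_pos)
  have ball: "measure lborel (ball y r) = r ^ DIM('a) * \<beta>" if "0 < r" for r and y :: 'a
    using content_ball_conv_unit_ball[of r y] that by (simp add: \<beta>_def)
  have mono: "measure lborel A \<le> measure lborel (ball x (3 * R) - \<Omega>)"
    if "A \<subseteq> ball x (3 * R) - \<Omega>" "A \<in> sets borel" for A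
  proof (rule measure_mono_fmeasurable)
    show "ball x (3 * R) - \<Omega> \<in> fmeasurable lborel"
    proof (rule fmeasurableI2)
      show "ball x (3 * R) \<in> fmeasurable lborel"
        using emeasure_lborel_ball_finite by (intro fmeasurableI) auto
    qed (use \<Omega>(1) in auto)
  qed (use that in auto)
  show ?thesis
  proof (cases "ball x (2 * R) \<inter> frontier \<Omega> = {}")
    case True
    then have "ball x (2 * R) \<subseteq> \<Omega> \<or> ball x (2 * R) \<inter> \<Omega> = {}"
      using connected_Int_frontier[OF connected_ball, of x "2 * R" \<Omega>] by blast
    moreover have "\<not> ball x (2 * R) \<subseteq> \<Omega>"
      using le_inradius[of "2 * R" x \<Omega>] \<Omega>(2,3) by auto
    ultimately have "ball x (2 * R) \<inter> \<Omega> = {}" by blast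
    moreover have "ball x R \<subseteq> ball x (2 * R)" "ball x R \<subseteq> ball x (3 * R)"
      using \<open>0 < R\<close> by (intro subset_ball; simp)+
    ultimately have "measure lborel (ball x R) \<le> measure lborel (ball x (3 * R) - \<Omega>)"
      by (intro mono) auto
    moreover have "min 1 (\<theta> * (min 1 \<kappa>1) ^ DIM('a) * (max 1 \<kappa>2) powr (- t0)) * measure lborel (ball x R)
        \<le> 1 * measure lborel (ball x R)"
      by (intro mult_right_mono) simp_all
    ultimately show ?thesis by simp
  next
    case False
    then obtain y where y: "y \<in> ball x (2 * R)" "y \<in> frontier \<Omega>" by auto
    define r where "r = min r0 R"
    have r: "0 < r" "r \<le> r0" "r \<le> R" using assms by (auto simp: r_def)
    have "ennreal \<theta> \<le> ennreal ((r0 / r) powr t * (measure lborel (ball y r - \<Omega>) / measure lborel (ball y r)))"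
    proof (rule order_trans[OF index(1)])
      show "density_index \<Omega> r0 t
          \<le> ennreal ((r0 / r) powr t * (measure lborel (ball y r - \<Omega>) / measure lborel (ball y r)))"
        unfolding density_index_def by (rule Inf_lower) (use y r in blast)
    qed
    then have "\<theta> \<le> (r0 / r) powr t * (measure lborel (ball y r - \<Omega>) / measure lborel (ball y r))"
      using index by (subst (asm) ennreal_le_iff) auto
    also have "\<dots> \<le> (max 1 \<kappa>2) powr t0 * (measure lborel (ball y r - \<Omega>) / measure lborel (ball y r))"
    proof (intro mult_right_mono)
      have "r0 / r \<le> max 1 \<kappa>2" using \<kappa> r by (auto simp: r_def min_def)
      then have "(r0 / r) powr t \<le> (max 1 \<kappa>2) powr t"
        using r index by (intro powr_mono2) auto
      also have "\<dots> \<le> (max 1 \<kappa>2) powr t0" using index by (intro powr_mono) auto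
      finally show "(r0 / r) powr t \<le> (max 1 \<kappa>2) powr t0" .
    qed auto
    finally have "\<theta> \<le> (max 1 \<kappa>2) powr t0 * (measure lborel (ball y r - \<Omega>) / (r ^ DIM('a) * \<beta>))"
      by (simp only: ball[OF r(1)])
    then have "\<theta> * ((max 1 \<kappa>2) powr (- t0) * (r ^ DIM('a) * \<beta>))
        \<le> (max 1 \<kappa>2) powr t0 * (measure lborel (ball y r - \<Omega>) / (r ^ DIM('a) * \<beta>))
          * ((max 1 \<kappa>2) powr (- t0) * (r ^ DIM('a) * \<beta>))"
      using r(1) \<open>0 < \<beta>\<close> by (intro mult_right_mono) simp_all
    also have "\<dots> = ((max 1 \<kappa>2) powr t0 * (max 1 \<kappa>2) powr (- t0)) * measure lborel (ball y r - \<Omega>)"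
      using r(1) \<open>0 < \<beta>\<close> by simp
    also have "(max 1 \<kappa>2) powr t0 * (max 1 \<kappa>2) powr (- t0) = 1"
      by (simp add: powr_add[symmetric])
    finally have "\<theta> * (max 1 \<kappa>2) powr (- t0) * (r ^ DIM('a) * \<beta>) \<le> measure lborel (ball y r - \<Omega>)"
      by (simp add: mult_ac)
    also have "ball y r - \<Omega> \<subseteq> ball x (3 * R) - \<Omega>"
    proof -
      have "dist x z < 3 * R" if "dist y z < r" for z
        using that y r dist_triangle[of x z y] by simp
      then show ?thesis by auto
    qed
    then have "measure lborel (ball y r - \<Omega>) \<le> measure lborel (ball x (3 * R) - \<Omega>)"
      using \<Omega> by (intro mono) auto
    finally have *: "\<theta> * (max 1 \<kappa>2) powr (- t0) * (r ^ DIM('a) * \<beta>) \<le> measure lborel (ball x (3 * R) - \<Omega>)" .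
    have "(min 1 \<kappa>1 * R) ^ DIM('a) \<le> r ^ DIM('a)"
    proof (rule power_mono)
      have "\<kappa>1 * R \<le> r0" using \<kappa> \<open>0 < R\<close> by (simp add: field_simps)
      moreover have "min 1 \<kappa>1 * R \<le> \<kappa>1 * R" "min 1 \<kappa>1 * R \<le> 1 * R"
        using \<open>0 < R\<close> by (intro mult_right_mono; simp)+
      ultimately show "min 1 \<kappa>1 * R \<le> r" by (simp add: r_def)
    qed (use \<kappa> \<open>0 < R\<close> in auto)
    then have "\<theta> * (max 1 \<kappa>2) powr (- t0) * ((min 1 \<kappa>1 * R) ^ DIM('a) * \<beta>)
        \<le> \<theta> * (max 1 \<kappa>2) powr (- t0) * (r ^ DIM('a) * \<beta>)"
      using \<open>0 < \<theta>\<close> \<open>0 < \<beta>\<close> by (intro mult_left_mono mult_right_mono) auto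
    with * have "\<theta> * (min 1 \<kappa>1) ^ DIM('a) * (max 1 \<kappa>2) powr (- t0) * measure lborel (ball x R)
        \<le> measure lborel (ball x (3 * R) - \<Omega>)"
      using \<open>0 < R\<close> by (simp add: ball power_mult_distrib mult_ac)
    then show ?thesis
      by (rule order_trans[rotated]) (intro mult_right_mono; simp)
  qed
qed

section \<open>Two-sided bounds and the criterion\<close>

lemma subcritical_exponent_pos:
  fixes N p q :: real
  assumes "1 \<le> p" "p \<le> N" "p \<le> q" "p < N \<Longrightarrow> q < N * p / (N - p)"
  shows "0 < p - N + N * p / q"
proof (cases "p < N")
  case True
  then have "q * (N - p) < N * p" using assms by (simp add: field_simps)
  then show ?thesis using assms by (simp add: field_simps)
next
  case False
  then show ?thesis using assms by (auto intro!: divide_pos_pos)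
qed

text \<open>Balls of every radius \<open>r < R\<close> fit into \<open>\<Omega>\<close>; the supremum \<open>R\<close> itself need not be attained, hence the
  limit \<open>r \<longlongrightarrow> R\<close>.\<close>

lemma poincare_sobolev_upper_bound:
  fixes \<Omega> :: "'a::euclidean_space set" and p q :: real
  defines "N \<equiv> real DIM('a)"
  defines "\<alpha> \<equiv> p - N + N * p / q"
  assumes "1 \<le> p" "1 \<le> q" and R: "inradius \<Omega> = ennreal R" "0 < R"
  shows "poincare_sobolev_const p q \<Omega> \<le> poincare_sobolev_const p q (ball (0::'a) 1) / ennreal (R powr \<alpha>)"
proof -
  obtain L where L: "poincare_sobolev_const p q (ball (0::'a) 1) = ennreal L" "0 \<le> L"
    using poincare_sobolev_const_unit_ball_finite[OF assms(3,4), where 'a='a]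
    by (cases "poincare_sobolev_const p q (ball (0::'a) 1)") auto
  have le: "poincare_sobolev_const p q \<Omega> * ennreal (r powr \<alpha>) \<le> ennreal L" if r: "0 < r" "r < R" for r
  proof -
    obtain x0 where "ball x0 r \<subseteq> \<Omega>"
      using ball_subset_if_less_inradius[of r \<Omega>] r R by (auto simp: ennreal_less_iff)
    from poincare_sobolev_const_scaling[OF assms(3,4) r(1) this] show ?thesis
      by (simp add: L \<alpha>_def N_def)
  qed
  have "poincare_sobolev_const p q \<Omega> \<noteq> \<infinity>"
    using le[of "R / 2"] R by (auto simp: ennreal_top_mult top_unique)
  then obtain l where l: "poincare_sobolev_const p q \<Omega> = ennreal l" "0 \<le> l"
    by (cases "poincare_sobolev_const p q \<Omega>") auto
  have "((\<lambda>r. l * r powr \<alpha>) \<longlongrightarrow> l * R powr \<alpha>) (at_left R)"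
    using R by (intro tendsto_intros) auto
  moreover have "\<forall>\<^sub>F r in at_left R. l * r powr \<alpha> \<le> L"
    using R le l L by (auto simp: eventually_at_left_field ennreal_mult[symmetric] intro!: exI[of _ 0])
  ultimately have "l * R powr \<alpha> \<le> L"
    by (rule tendsto_upperbound) auto
  then show ?thesis
    using R L l by (simp add: divide_ennreal field_simps ennreal_leI)
qed

lemma poincare_sobolev_zero_if_inradius_infinite:
  fixes \<Omega> :: "'a::euclidean_space set"
  assumes "1 \<le> p" "1 \<le> q" "0 < p - real DIM('a) + real DIM('a) * p / q" and "inradius \<Omega> = \<infinity>"
  shows "poincare_sobolev_const p q \<Omega> = 0"
proof -
  define \<alpha> where "\<alpha> = p - real DIM('a) + real DIM('a) * p / q"
  obtain L where L: "poincare_sobolev_const p q (ball (0::'a) 1) = ennreal L" "0 \<le> L"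
    using poincare_sobolev_const_unit_ball_finite[OF assms(1,2), where 'a='a]
    by (cases "poincare_sobolev_const p q (ball (0::'a) 1)") auto
  have le: "poincare_sobolev_const p q \<Omega> * ennreal (r powr \<alpha>) \<le> ennreal L" if r: "0 < r" for r
  proof -
    obtain x0 where "ball x0 r \<subseteq> \<Omega>"
      using ball_subset_if_less_inradius[of r \<Omega>] assms(4) by auto
    from poincare_sobolev_const_scaling[OF assms(1,2) r this] show ?thesis
      by (simp add: L \<alpha>_def)
  qed
  have "poincare_sobolev_const p q \<Omega> \<noteq> \<infinity>"
    using le[of 1] by (auto simp: top_unique)
  then obtain l where l: "poincare_sobolev_const p q \<Omega> = ennreal l" "0 \<le> l"
    by (cases "poincare_sobolev_const p q \<Omega>") auto
  have "l = 0"
  proof (rule ccontr)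
    assume "l \<noteq> 0"
    then have "0 < l" using l by simp
    define r where "r = ((L + 1) / l) powr (1 / \<alpha>)"
    have "0 < r" "r powr \<alpha> = (L + 1) / l"
      using \<open>0 < l\<close> L assms(3) by (auto simp: r_def powr_powr \<alpha>_def[symmetric])
    with le[of r] l L \<open>0 < l\<close> show False by (simp add: ennreal_mult[symmetric])
  qed
  then show ?thesis using l by simp
qed

text \<open>The upper bound \<open>\<kappa>2\<close> and the exponent bound \<open>t0\<close> influence the constant only through
  \<open>K = (max 1 \<kappa>2) powr t0\<close>. Quantifying over all \<open>\<kappa>2\<close> and \<open>t0\<close> with this value covers both the general case
  and, with \<open>K = 1\<close>, the independence of \<open>\<kappa>2\<close> for \<open>t0 = 0\<close>.\<close>

lemma uniform_inradius_bounds: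
  fixes p q :: real
  assumes "1 \<le> p" "p \<le> q" "0 < p - real DIM('a::euclidean_space) + real DIM('a) * p / q"
    and "0 < \<theta>" "0 < \<kappa>1" "0 < K"
  shows "\<exists>c>0. \<forall>\<kappa>2 t0 (\<Omega>::'a set) r0 t.
      (max 1 \<kappa>2) powr t0 = K \<and> open \<Omega> \<and> 0 < r0 \<and> 0 \<le> t \<and> t \<le> t0 \<and> ennreal \<theta> \<le> density_index \<Omega> r0 t \<and>
      ennreal \<kappa>1 \<le> ennreal r0 / inradius \<Omega> \<and> ennreal r0 / inradius \<Omega> \<le> ennreal \<kappa>2
      \<longrightarrow> inradius_bounds c p q \<Omega>"
proof -
  define \<alpha> where "\<alpha> = p - real DIM('a) + real DIM('a) * p / q"
  define s where "s = min 1 (\<theta> * (min 1 \<kappa>1) ^ DIM('a) * inverse K)"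
  have "0 < s" using assms by (simp add: s_def)
  obtain c where "0 < c" and c: "\<And>(\<Omega>::'a set) R. open \<Omega> \<Longrightarrow> 0 < R \<Longrightarrow>
      (\<And>x. s * measure lborel (ball x R) \<le> measure lborel (ball x (3 * R) - \<Omega>)) \<Longrightarrow>
      ennreal (c / R powr \<alpha>) \<le> poincare_sobolev_const p q \<Omega>"
    using poincare_sobolev_lower_bound[OF assms(1-3) \<open>0 < s\<close>] unfolding \<alpha>_def by blast
  have "inradius_bounds c p q \<Omega>"
    if K: "(max 1 \<kappa>2) powr t0 = K"
      and \<Omega>: "open \<Omega>" "0 < r0" "0 \<le> t" "t \<le> t0" "ennreal \<theta> \<le> density_index \<Omega> r0 t"
      and \<kappa>: "ennreal \<kappa>1 \<le> ennreal r0 / inradius \<Omega>" "ennreal r0 / inradius \<Omega> \<le> ennreal \<kappa>2"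
    for \<kappa>2 t0 and \<Omega> :: "'a set" and r0 t
  proof -
    have "inradius \<Omega> \<noteq> 0" using \<kappa>(2) \<open>0 < r0\<close> by (auto simp: ennreal_divide_zero top_unique)
    moreover have "inradius \<Omega> \<noteq> \<infinity>" using \<kappa>(1) \<open>0 < \<kappa>1\<close> by auto
    ultimately obtain R where R: "inradius \<Omega> = ennreal R" "0 < R"
      by (cases "inradius \<Omega>") (auto simp: less_le)
    have ratio: "\<kappa>1 \<le> r0 / R" using \<kappa>(1) R \<open>0 < r0\<close>
      by (simp add: divide_ennreal ennreal_le_iff)
    have "0 < \<kappa>2"
      using \<kappa>(2) R \<open>0 < r0\<close> by (cases "0 < \<kappa>2") (auto simp: divide_ennreal ennreal_neg)
    then have ratio2: "r0 / R \<le> \<kappa>2" using \<kappa>(2) R \<open>0 < r0\<close>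
      by (simp add: divide_ennreal ennreal_le_iff)
    have "s * measure lborel (ball x R) \<le> measure lborel (ball x (3 * R) - \<Omega>)" for x
      using complement_density[OF \<Omega>(1) R \<Omega>(5) \<open>0 < \<theta>\<close> \<Omega>(2,3,4) \<open>0 < \<kappa>1\<close> ratio ratio2, of x] K
      by (simp add: s_def powr_minus)
    from c[OF \<Omega>(1) R(2) this] have "ennreal c / ennreal (R powr \<alpha>) \<le> poincare_sobolev_const p q \<Omega>"
      using \<open>0 < c\<close> R by (simp add: divide_ennreal)
    moreover have "1 \<le> q" using assms by simp
    ultimately show ?thesis
      using poincare_sobolev_upper_bound[OF assms(1) _ R, of q] R
      by (simp add: inradius_bounds_def \<alpha>_def Let_def)
  qed
  then show ?thesis using \<open>0 < c\<close> by blast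
qed

theorem corollary5p6:
  fixes p q :: real
  assumes "2 \<le> DIM('a::euclidean_space)"
    and "1 \<le> p" and "p \<le> real DIM('a)" and "p \<le> q"
    and "p < real DIM('a) \<Longrightarrow> q < real DIM('a) * p / (real DIM('a) - p)"
  shows "(\<forall>(\<Omega>::'a set) r0 t. open \<Omega> \<and> 0 < r0 \<and> 0 \<le> t \<and> 0 < density_index \<Omega> r0 t \<longrightarrow>
            (0 < poincare_sobolev_const p q \<Omega> \<longleftrightarrow> inradius \<Omega> < \<infinity>))
    \<and> (\<forall>t0 \<theta> \<kappa>1 \<kappa>2. 0 < \<theta> \<and> 0 < \<kappa>1 \<longrightarrow>
         (\<exists>c>0. \<forall>(\<Omega>::'a set) r0 t.
            open \<Omega> \<and> 0 < r0 \<and> 0 \<le> t \<and> t \<le> t0 \<and> ennreal \<theta> \<le> density_index \<Omega> r0 t \<and>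
            ennreal \<kappa>1 \<le> ennreal r0 / inradius \<Omega> \<and> ennreal r0 / inradius \<Omega> \<le> ennreal \<kappa>2
            \<longrightarrow> inradius_bounds c p q \<Omega>))
    \<and> (\<forall>t0 \<theta> \<kappa>1. t0 = 0 \<and> 0 < \<theta> \<and> 0 < \<kappa>1 \<longrightarrow>
         (\<exists>c>0. \<forall>\<kappa>2 (\<Omega>::'a set) r0 t.
            open \<Omega> \<and> 0 < r0 \<and> 0 \<le> t \<and> t \<le> t0 \<and> ennreal \<theta> \<le> density_index \<Omega> r0 t \<and>
            ennreal \<kappa>1 \<le> ennreal r0 / inradius \<Omega> \<and> ennreal r0 / inradius \<Omega> \<le> ennreal \<kappa>2
            \<longrightarrow> inradius_bounds c p q \<Omega>))"
proof (intro conjI allI impI; (elim conjE)?)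
  have \<alpha>: "0 < p - real DIM('a) + real DIM('a) * p / q"
    using assms by (intro subcritical_exponent_pos)
  have "1 \<le> q" using assms by simp
  have pos: "0 < (max 1 x) powr y" for x y :: real by (simp add: max_def)
  note uniform = uniform_inradius_bounds[OF assms(2,4) \<alpha>]
  {
    fix t0 \<theta> \<kappa>1 \<kappa>2 :: real assume \<theta>: "0 < \<theta>" and \<kappa>1: "0 < \<kappa>1"
    obtain c where c: "0 < c" and bounds: "\<forall>\<kappa> t1 (\<Omega>::'a set) r0 t.
        (max 1 \<kappa>) powr t1 = (max 1 \<kappa>2) powr t0 \<and>
        open \<Omega> \<and> 0 < r0 \<and> 0 \<le> t \<and> t \<le> t1 \<and> ennreal \<theta> \<le> density_index \<Omega> r0 t \<and>
        ennreal \<kappa>1 \<le> ennreal r0 / inradius \<Omega> \<and> ennreal r0 / inradius \<Omega> \<le> ennreal \<kappa>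
        \<longrightarrow> inradius_bounds c p q \<Omega>"
      using uniform[OF \<theta> \<kappa>1 pos[of \<kappa>2 t0]] by (elim exE conjE) (rule that)
    show "\<exists>c>0. \<forall>(\<Omega>::'a set) r0 t.
        open \<Omega> \<and> 0 < r0 \<and> 0 \<le> t \<and> t \<le> t0 \<and> ennreal \<theta> \<le> density_index \<Omega> r0 t \<and>
        ennreal \<kappa>1 \<le> ennreal r0 / inradius \<Omega> \<and> ennreal r0 / inradius \<Omega> \<le> ennreal \<kappa>2
        \<longrightarrow> inradius_bounds c p q \<Omega>"
      using c spec[OF spec[OF bounds, of \<kappa>2], of t0] by (intro exI[of _ c]) simp
  next
    fix t0 \<theta> \<kappa>1 :: real assume "t0 = 0" and \<theta>: "0 < \<theta>" and \<kappa>1: "0 < \<kappa>1"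
    obtain c where c: "0 < c" and bounds: "\<forall>\<kappa>2 t1 (\<Omega>::'a set) r0 t.
        (max 1 \<kappa>2) powr t1 = 1 \<and>
        open \<Omega> \<and> 0 < r0 \<and> 0 \<le> t \<and> t \<le> t1 \<and> ennreal \<theta> \<le> density_index \<Omega> r0 t \<and>
        ennreal \<kappa>1 \<le> ennreal r0 / inradius \<Omega> \<and> ennreal r0 / inradius \<Omega> \<le> ennreal \<kappa>2
        \<longrightarrow> inradius_bounds c p q \<Omega>"
      using uniform[OF \<theta> \<kappa>1 zero_less_one] by (elim exE conjE) (rule that)
    have "\<forall>(\<Omega>::'a set) r0 t.
        open \<Omega> \<and> 0 < r0 \<and> 0 \<le> t \<and> t \<le> t0 \<and> ennreal \<theta> \<le> density_index \<Omega> r0 t \<and>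
        ennreal \<kappa>1 \<le> ennreal r0 / inradius \<Omega> \<and> ennreal r0 / inradius \<Omega> \<le> ennreal \<kappa>2
        \<longrightarrow> inradius_bounds c p q \<Omega>" for \<kappa>2
      using spec[OF spec[OF bounds, of \<kappa>2], of t0] \<open>t0 = 0\<close> by simp
    then show "\<exists>c>0. \<forall>\<kappa>2 (\<Omega>::'a set) r0 t.
        open \<Omega> \<and> 0 < r0 \<and> 0 \<le> t \<and> t \<le> t0 \<and> ennreal \<theta> \<le> density_index \<Omega> r0 t \<and>
        ennreal \<kappa>1 \<le> ennreal r0 / inradius \<Omega> \<and> ennreal r0 / inradius \<Omega> \<le> ennreal \<kappa>2
        \<longrightarrow> inradius_bounds c p q \<Omega>"
      by (intro exI[of _ c] conjI c) (rule allI)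
  next
    fix \<Omega> :: "'a set" and r0 t :: real
    assume \<Omega>: "open \<Omega>" "0 < r0" "0 \<le> t" "0 < density_index \<Omega> r0 t"
    show "0 < poincare_sobolev_const p q \<Omega> \<longleftrightarrow> inradius \<Omega> < \<infinity>"
    proof
      assume "0 < poincare_sobolev_const p q \<Omega>"
      then show "inradius \<Omega> < \<infinity>"
        using poincare_sobolev_zero_if_inradius_infinite[OF assms(2) \<open>1 \<le> q\<close> \<alpha>, of \<Omega>]
        by (cases "inradius \<Omega>") auto
    next
      assume fin: "inradius \<Omega> < \<infinity>"
      show "0 < poincare_sobolev_const p q \<Omega>"
      proof (cases "\<Omega> = {}")
        case True
        \<comment> \<open>The empty set has inradius \<open>0\<close>, so the two-sided bounds do not cover it; its constant is the infimum of the empty set.\<close>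
        have "{\<phi> \<in> test_functions \<Omega>. Lq_norm q \<Omega> \<phi> = 1} = {}"
          using True \<open>1 \<le> q\<close> by (auto simp: Lq_norm_def set_lebesgue_integral_def)
        then have "poincare_sobolev_const p q \<Omega> = \<infinity>"
          unfolding poincare_sobolev_const_def by (simp only: image_empty Inf_empty infinity_ennreal_def)
        then show ?thesis by simp
      next
        case False
        then obtain x r where "0 < r" "ball x r \<subseteq> \<Omega>" using \<Omega>(1) by (metis ex_in_conv openE)
        then have "0 < inradius \<Omega>"
          using le_inradius[of r x \<Omega>] by (auto intro: less_le_trans[of _ "ennreal r"])
        then obtain R where R: "inradius \<Omega> = ennreal R" "0 < R"
          using fin by (cases "inradius \<Omega>") auto
        \<comment> \<open>For a single domain, \<open>r0 / R\<close> serves as both \<open>\<kappa>1\<close> and \<open>\<kappa>2\<close>, and \<open>t\<close> as \<open>t0\<close>.\<close>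
        define \<kappa> where "\<kappa> = r0 / R"
        have "0 < \<kappa>" using R \<Omega> by (simp add: \<kappa>_def)
        obtain \<theta> where \<theta>: "0 < \<theta>" "ennreal \<theta> \<le> density_index \<Omega> r0 t"
        proof (cases "density_index \<Omega> r0 t")
          case (real i)
          then show ?thesis using that[of i] \<Omega>(4) by simp
        next
          case top
          then show ?thesis using that[of 1] by simp
        qed
        have ratio: "ennreal r0 / inradius \<Omega> = ennreal \<kappa>"
          using R \<Omega> by (simp add: divide_ennreal \<kappa>_def)
        obtain c where "0 < c" and bounds: "\<forall>\<kappa>2 t1 (\<Omega>::'a set) r0 t'.
            (max 1 \<kappa>2) powr t1 = (max 1 \<kappa>) powr t \<and>
            open \<Omega> \<and> 0 < r0 \<and> 0 \<le> t' \<and> t' \<le> t1 \<and> ennreal \<theta> \<le> density_index \<Omega> r0 t' \<and>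
            ennreal \<kappa> \<le> ennreal r0 / inradius \<Omega> \<and> ennreal r0 / inradius \<Omega> \<le> ennreal \<kappa>2
            \<longrightarrow> inradius_bounds c p q \<Omega>"
          using uniform[OF \<theta>(1) \<open>0 < \<kappa>\<close> pos[of \<kappa> t]] by (elim exE conjE) (rule that)
        have "inradius_bounds c p q \<Omega>"
          by (rule bounds[rule_format, of \<kappa> t \<Omega> r0 t]) (use \<Omega> \<theta> ratio in simp)
        then have "ennreal c / ennreal (R powr (p - real DIM('a) + real DIM('a) * p / q))
            \<le> poincare_sobolev_const p q \<Omega>"
          using R by (simp add: inradius_bounds_def Let_def)
        moreover have "0 < ennreal c / ennreal (R powr (p - real DIM('a) + real DIM('a) * p / q))"
          using \<open>0 < c\<close> R by (simp add: divide_ennreal)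
        ultimately show ?thesis by (rule less_le_trans[rotated])
      qed
    qed
  }
qed

end
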